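(* Suppose (H.1) and (H.2) (stated in the context) hold. Let $\beta_0\in(0,1)$ be the constant described in the context, let $u\in C(\overline{\mathcal O})\cap C^2(\mathcal O)$ be the solution to $H_0(\mathbf Lu+\mathbf f)=0$ in $\mathcal O$, $u=g$ on $\partial\mathcal O$, and for $\varepsilon>0$ let $u^\varepsilon\in C(\overline{\mathcal O})\cap C^2(\mathcal O)$ be the solution to $H_\varepsilon(\mathbf Lu^\varepsilon+\mathbf f)=0$ in $\mathcal O$, $u^\varepsilon=g$ on $\partial\mathcal O$. Then $u^{\varepsilon_1}\ge u^{\varepsilon_2}$ for all $\varepsilon_1\ge\varepsilon_2>0$. Moreover, for any $\beta\in(0,\min(\beta_0,\theta))$, $(u^\varepsilon)_{\varepsilon>0}$ converges to $u$ in $C^{2,\beta}(\overline{\mathcal O})$ as $\varepsilon\to0$, and satisfies the estimate $$0\le u^\varepsilon-u\le\bigg(\exp\Big[\Big(\tfrac{\max_{k\in\mathcal K}\sum_{i=1}^n|b_k^i|_0}{\nu/2}+1\Big)\operatorname{diam}(\mathcal O)\Big]-1\bigg)\frac{2\varepsilon c_0}{\nu}.$$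
   Context: Norms: for open $\mathcal O\subset\mathbb R^n$, $k\in\mathbb N\cup\{0\}$, $\theta\in(0,1]$, $|\phi|_0=[\phi]_0=\sup|\phi|$, $[\phi]_\theta=\sup_{x\ne y}|\phi(x)-\phi(y)|/|x-y|^\theta$, $[\phi]_{k,0}=\sum_{|\gamma|=k}[D^\gamma\phi]_0$, $[\phi]_{k,\theta}=\sum_{|\gamma|=k}[D^\gamma\phi]_\theta$, $|\phi|_k=\sum_{m=0}^k[\phi]_{m,0}$, $|\phi|_{k,\theta}=|\phi|_k+[\phi]_{k,\theta}$, $|\cdot|_\theta=|\cdot|_{0,\theta}$; domain subscript omitted when it is $\overline{\mathcal O}$; $C^{k,\theta}(\overline{\mathcal O})$ are the corresponding Hölder spaces. Repeated indices $i,j$ in operators are summed from $1$ to $n$. (H.1): $n,K\in\mathbb N$, $\mathcal K=\{1,\dots,K\}$, $\mathbf A=\{\mathbf a_k\}_{k\in\mathcal K}$ is a set of cardinality $K$, $\mathcal O\subset\mathbb R^n$ is a bounded domain. There are constants $\nu,\Lambda>0$, $\theta\in(0,1]$ such that $\partial\mathcal O$ is of class $C^{2,\theta}$, $g\in C^{2,\theta}(\overline{\mathcal O})$, and $b:\mathbb R^n\times\mathbf A\to\mathbb R^n$, $\sigma:\mathbb R^n\times\mathbf A\to\mathbb R^{n\times n}$, $c:\overline{\mathcal O}\times\mathbf A\to[0,\infty)$, $f:\overline{\mathcal O}\times\mathbf A\to\mathbb R$ satisfy for each $k$: $\sigma(x,\mathbf a_k)\sigma^T(x,\mathbf a_k)\ge\nu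 I_n$ for all $x\in\mathbb R^n$, and $\sum_{i,j}|\sigma^{ij}(\cdot,\mathbf a_k)|_{0,1;\mathbb R^n}+\sum_i|b^i(\cdot,\mathbf a_k)|_{0,1;\mathbb R^n}+|c(\cdot,\mathbf a_k)|_{\theta;\overline{\mathcal O}}+|f(\cdot,\mathbf a_k)|_{\theta;\overline{\mathcal O}}\le\Lambda$. Write $\phi_k=\phi(\cdot,\mathbf a_k)$. (H.2): there exist a convex $H\in C^2(\mathbb R^K)$ and $c_0>0$ such that for all $x,y\in\mathbb R^K$, $H(x)-c_0\le\max_kx_k\le H(x)$ and $\rho(y)=\sup_{z\in\mathbb R^K}(z^Ty-H(z))$. $H_\varepsilon(x)=\varepsilon H(\varepsilon^{-1}x)$ for $\varepsilon>0$ and $H_0(x)=\max_{k\in\mathcal K}x_k$. $\mathbf f=(f_k)_k$, $\mathbf L=(\mathcal L_k)_k$ with $\mathcal L_k\phi=a_k^{ij}\partial_{ij}\phi+b_k^i\partial_i\phi-c_k\phi$, $a_k=\tfrac12\sigma_k\sigma_k^T$. The constant $\beta_0=\beta_0(n,\nu,M)\in(0,1)$, $M=\sup_{i,j,k}|\sigma_k^{ij}|_{0;\overline{\mathcal O}}$, depends only on $n,\nu,M$ and is such that, under (H.1)–(H.2), for every $\varepsilon>0$ the unique solution $u^\varepsilon\in C(\overline{\mathcal O})\cap C^2(\mathcal O)$ of $H_\varepsilon(\mathbf Lu^\varepsilon+\mathbf f)=0$ in $\mathcal O$, $u^\varepsilon=g$ on $\partial\mathcal O$ lies in $C^{2,\min(\beta_0,\theta)}(\overline{\mathcal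 O})$, and for every $\beta\in(0,\min(\beta_0,\theta)]$ every $C^{2,\beta}(\overline{\mathcal O})$ solution satisfies $|u^\varepsilon|_{2,\beta}\le C(|g|_{2,\beta}+\varepsilon c_0+1)$ with $C$ depending only on $n,\nu,\Lambda,\beta,\mathcal O$. (Existence of such a $\beta_0$ is established separately.) *)

theory Defs
  imports "HOL-Analysis.Analysis" "HOL-Library.Multiset"
begin

section \<open>Derivatives and the classes \<open>C\<^sup>k\<close>\<close>

definition pd :: "'n::finite \<Rightarrow> (real^'n \<Rightarrow> real) \<Rightarrow> real^'n \<Rightarrow> real" where
  "pd i \<phi> x = frechet_derivative \<phi> (at x) (axis i 1)"

primrec C_class :: "nat \<Rightarrow> (real^'n::finite) set \<Rightarrow> (real^'n \<Rightarrow> real) \<Rightarrow> bool" where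
  "C_class 0 S \<phi> \<longleftrightarrow> continuous_on S \<phi>"
| "C_class (Suc k) S \<phi> \<longleftrightarrow> (\<forall>x\<in>S. \<phi> differentiable (at x)) \<and> (\<forall>i. C_class k S (pd i \<phi>))"

text \<open>A multi-index is a multiset of coordinate directions, and its order is its size. The order
  in which the partial derivatives are taken is irrelevant for functions of class \<open>C\<^sup>k\<close>.\<close>

definition D_multi :: "'n::finite multiset \<Rightarrow> (real^'n \<Rightarrow> real) \<Rightarrow> real^'n \<Rightarrow> real" where
  "D_multi \<gamma> \<phi> = foldr pd (SOME is. mset is = \<gamma>) \<phi>"

text \<open>\<open>D\<^sup>\<gamma>\<phi>\<close> as a function on the closure of the open set \<open>S\<close>: genuine derivatives are
  taken inside \<open>S\<close> and extended to the boundary by their limits.  For the empty multi-index it is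
  \<open>\<phi>\<close> itself, which is always given on the whole closure.\<close>

definition D_cl :: "(real^'n::finite) set \<Rightarrow> 'n multiset \<Rightarrow> (real^'n \<Rightarrow> real) \<Rightarrow> real^'n \<Rightarrow> real" where
  "D_cl S \<gamma> \<phi> x =
     (if \<gamma> = {#} then \<phi> x
      else if x \<in> S then D_multi \<gamma> \<phi> x
      else Lim (at x within S) (D_multi \<gamma> \<phi>))"

text \<open>The norms below sum over all multi-indices of a given order; there are finitely many.\<close>

lemma finite_multi_indices: "finite {\<gamma> :: 'n::finite multiset. size \<gamma> = m}"
proof -
  have "{\<gamma> :: 'n multiset. size \<gamma> = m} \<subseteq> mset ` {l. set l \<subseteq> UNIV \<and> length l = m}"
  proof
    fix \<gamma> :: "'n multiset"
    assume "\<gamma> \<in> {\<gamma>. size \<gamma> = m}"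
    moreover obtain l where "mset l = \<gamma>" using ex_mset by blast
    ultimately show "\<gamma> \<in> mset ` {l. set l \<subseteq> UNIV \<and> length l = m}" by auto
  qed
  then show ?thesis
    using finite_lists_length_eq[of "UNIV :: 'n set" m] by (meson finite finite_imageI finite_subset)
qed


section \<open>Hoelder norms and spaces\<close>

text \<open>All (semi)norms take values in \<^typ>\<open>ennreal\<close>, so that they are meaningful for every function.
  In the functions with an open set \<open>S\<close> as argument the norm is the one over \<open>closure S\<close>.\<close>

definition sup_norm :: "(real^'n::finite) set \<Rightarrow> (real^'n \<Rightarrow> real) \<Rightarrow> ennreal" where
  "sup_norm X \<phi> = (SUP x\<in>X. ennreal \<bar>\<phi> x\<bar>)"

definition holder_quot :: "real \<Rightarrow> (real^'n::finite) set \<Rightarrow> (real^'n \<Rightarrow> real) \<Rightarrow> ennreal" where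
  "holder_quot \<theta> X \<phi> =
     (SUP (x, y) \<in> {(x, y). x \<in> X \<and> y \<in> X \<and> x \<noteq> y}. ennreal (\<bar>\<phi> x - \<phi> y\<bar> / norm (x - y) powr \<theta>))"

definition semi_sup :: "nat \<Rightarrow> (real^'n::finite) set \<Rightarrow> (real^'n \<Rightarrow> real) \<Rightarrow> ennreal" where
  "semi_sup k S \<phi> = (\<Sum>\<gamma> | size \<gamma> = k. sup_norm (closure S) (D_cl S \<gamma> \<phi>))"

definition semi_holder :: "nat \<Rightarrow> real \<Rightarrow> (real^'n::finite) set \<Rightarrow> (real^'n \<Rightarrow> real) \<Rightarrow> ennreal" where
  "semi_holder k \<theta> S \<phi> = (\<Sum>\<gamma> | size \<gamma> = k. holder_quot \<theta> (closure S) (D_cl S \<gamma> \<phi>))"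

definition holder_norm :: "nat \<Rightarrow> real \<Rightarrow> (real^'n::finite) set \<Rightarrow> (real^'n \<Rightarrow> real) \<Rightarrow> ennreal" where
  "holder_norm k \<theta> S \<phi> = (\<Sum>m\<le>k. semi_sup m S \<phi>) + semi_holder k \<theta> S \<phi>"

definition holder_space :: "nat \<Rightarrow> real \<Rightarrow> (real^'n::finite) set \<Rightarrow> (real^'n \<Rightarrow> real) set" where
  "holder_space k \<theta> S = {\<phi>. C_class k S \<phi>
     \<and> (\<forall>\<gamma>. size \<gamma> \<le> k \<longrightarrow> continuous_on (closure S) (D_cl S \<gamma> \<phi>))
     \<and> holder_norm k \<theta> S \<phi> < \<infinity>}"

text \<open>Boundary of class \<open>C\<^bsup>k,\<theta>\<^esup>\<close> in the sense of Gilbarg--Trudinger (Section 6.2): near every boundary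
  point a \<open>C\<^bsup>k,\<theta>\<^esup>\<close> diffeomorphism of a ball straightens the boundary.  The half space is
  \<open>{y. y\<^sub>l > 0}\<close> for some coordinate \<open>l\<close>; which one is immaterial.\<close>

definition boundary_class :: "nat \<Rightarrow> real \<Rightarrow> (real^'n::finite) set \<Rightarrow> bool" where
  "boundary_class k \<theta> S \<longleftrightarrow> (\<forall>x0 \<in> frontier S. \<exists>r>0. \<exists>D (\<psi> :: real^'n \<Rightarrow> real^'n) \<eta> l.
     open D \<and> homeomorphism (ball x0 r) D \<psi> \<eta>
     \<and> \<psi> ` (ball x0 r \<inter> S) \<subseteq> {y. y $ l > 0}
     \<and> \<psi> ` (ball x0 r \<inter> frontier S) \<subseteq> {y. y $ l = 0}
     \<and> (\<forall>i. (\<lambda>x. \<psi> x $ i) \<in> holder_space k \<theta> (ball x0 r))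
     \<and> (\<forall>i. (\<lambda>y. \<eta> y $ i) \<in> holder_space k \<theta> D))"


section \<open>Functions on \<open>\<real>\<^sup>K\<close>\<close>

text \<open>Since the regularity constant below has to be uniform in \<open>K\<close>, the number \<open>K\<close> is quantified
  inside a formula; therefore \<open>\<real>\<^sup>K\<close> is the set of functions \<open>nat \<Rightarrow> real\<close> vanishing
  outside \<open>{1..K}\<close>.  Its subspace topology from the product topology is the Euclidean one.\<close>

definition RK :: "nat \<Rightarrow> (nat \<Rightarrow> real) set" where
  "RK K = {x. \<forall>k. k \<notin> {1..K} \<longrightarrow> x k = 0}"

definition RK_vec :: "nat \<Rightarrow> (nat \<Rightarrow> real) \<Rightarrow> nat \<Rightarrow> real" where
  "RK_vec K x = (\<lambda>k. if k \<in> {1..K} then x k else 0)"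

definition RK_convex :: "nat \<Rightarrow> ((nat \<Rightarrow> real) \<Rightarrow> real) \<Rightarrow> bool" where
  "RK_convex K H \<longleftrightarrow> (\<forall>x\<in>RK K. \<forall>y\<in>RK K. \<forall>t\<in>{0..1}.
     H (\<lambda>k. (1 - t) * x k + t * y k) \<le> (1 - t) * H x + t * H y)"

definition RK_pd :: "nat \<Rightarrow> ((nat \<Rightarrow> real) \<Rightarrow> real) \<Rightarrow> (nat \<Rightarrow> real) \<Rightarrow> real" where
  "RK_pd k H x = deriv (\<lambda>t. H (x(k := t))) (x k)"

text \<open>\<open>C\<^sup>m(\<real>\<^sup>K)\<close>: \<open>H\<close> is continuous and all partial derivatives up to order \<open>m\<close> exist
  and are continuous.\<close>

primrec RK_C_class :: "nat \<Rightarrow> nat \<Rightarrow> ((nat \<Rightarrow> real) \<Rightarrow> real) \<Rightarrow> bool" where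
  "RK_C_class K 0 H \<longleftrightarrow> continuous_on (RK K) H"
| "RK_C_class K (Suc m) H \<longleftrightarrow> continuous_on (RK K) H
     \<and> (\<forall>k\<in>{1..K}. (\<forall>x\<in>RK K. (\<lambda>t. H (x(k := t))) differentiable (at (x k)))
                     \<and> RK_C_class K m (RK_pd k H))"


section \<open>Hypotheses, operators and solutions\<close>

text \<open>The index set is \<open>{1..K}\<close> and \<open>a\<close> enumerates the control set without repetition;
  \<open>\<phi>\<^sub>k\<close> is \<open>\<lambda>x. \<phi> x (a k)\<close>.\<close>

definition H1 :: "nat \<Rightarrow> (nat \<Rightarrow> 'a) \<Rightarrow> 'a set \<Rightarrow> (real^'n::finite) set \<Rightarrow> real \<Rightarrow> real \<Rightarrow> real \<Rightarrow>
    (real^'n \<Rightarrow> real) \<Rightarrow> (real^'n \<Rightarrow> 'a \<Rightarrow> real^'n) \<Rightarrow> (real^'n \<Rightarrow> 'a \<Rightarrow> real^'n^'n) \<Rightarrow>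
    (real^'n \<Rightarrow> 'a \<Rightarrow> real) \<Rightarrow> (real^'n \<Rightarrow> 'a \<Rightarrow> real) \<Rightarrow> bool" where
  "H1 K a A S \<nu> \<Lambda> \<theta> g b \<sigma> c f \<longleftrightarrow>
     K \<ge> 1 \<and> bij_betw a {1..K} A
     \<and> open S \<and> connected S \<and> S \<noteq> {} \<and> bounded S
     \<and> \<nu> > 0 \<and> \<Lambda> > 0 \<and> 0 < \<theta> \<and> \<theta> \<le> 1
     \<and> boundary_class 2 \<theta> S \<and> g \<in> holder_space 2 \<theta> S
     \<and> (\<forall>k\<in>{1..K}.
          (\<forall>x\<in>closure S. 0 \<le> c x (a k))
        \<and> (\<forall>x \<xi>. \<xi> \<bullet> ((\<sigma> x (a k) ** transpose (\<sigma> x (a k))) *v \<xi>) \<ge> \<nu> * (\<xi> \<bullet> \<xi>))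
        \<and> (\<Sum>i\<in>UNIV. \<Sum>j\<in>UNIV. holder_norm 0 1 UNIV (\<lambda>x. \<sigma> x (a k) $ i $ j))
          + (\<Sum>i\<in>UNIV. holder_norm 0 1 UNIV (\<lambda>x. b x (a k) $ i))
          + holder_norm 0 \<theta> S (\<lambda>x. c x (a k))
          + holder_norm 0 \<theta> S (\<lambda>x. f x (a k)) \<le> ennreal \<Lambda>)"

definition H2 :: "nat \<Rightarrow> ((nat \<Rightarrow> real) \<Rightarrow> real) \<Rightarrow> real \<Rightarrow> ((nat \<Rightarrow> real) \<Rightarrow> ereal) \<Rightarrow> bool" where
  "H2 K H c0 \<rho> \<longleftrightarrow> RK_convex K H \<and> RK_C_class K 2 H \<and> c0 > 0
     \<and> (\<forall>x\<in>RK K. H x - c0 \<le> Max (x ` {1..K}) \<and> Max (x ` {1..K}) \<le> H x)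
     \<and> (\<forall>y\<in>RK K. \<rho> y = (SUP z\<in>RK K. ereal ((\<Sum>k\<in>{1..K}. z k * y k) - H z)))"

definition H_eps :: "((nat \<Rightarrow> real) \<Rightarrow> real) \<Rightarrow> real \<Rightarrow> (nat \<Rightarrow> real) \<Rightarrow> real" where
  "H_eps H \<epsilon> x = \<epsilon> * H (\<lambda>k. x k / \<epsilon>)"

definition H_zero :: "nat \<Rightarrow> (nat \<Rightarrow> real) \<Rightarrow> real" where
  "H_zero K x = Max (x ` {1..K})"

definition L_op :: "(nat \<Rightarrow> 'a) \<Rightarrow> (real^'n::finite \<Rightarrow> 'a \<Rightarrow> real^'n) \<Rightarrow> (real^'n \<Rightarrow> 'a \<Rightarrow> real^'n^'n) \<Rightarrow>
    (real^'n \<Rightarrow> 'a \<Rightarrow> real) \<Rightarrow> nat \<Rightarrow> (real^'n \<Rightarrow> real) \<Rightarrow> real^'n \<Rightarrow> real" where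
  "L_op a b \<sigma> c k \<phi> x =
     (\<Sum>i\<in>UNIV. \<Sum>j\<in>UNIV.
        ((1/2) *\<^sub>R (\<sigma> x (a k) ** transpose (\<sigma> x (a k)))) $ i $ j * pd i (pd j \<phi>) x)
     + (\<Sum>i\<in>UNIV. b x (a k) $ i * pd i \<phi> x) - c x (a k) * \<phi> x"

text \<open>\<open>u \<in> C(closure S) \<inter> C\<^sup>2(S)\<close> solves \<open>F (\<^bold>L u + \<^bold>f) = 0\<close> in \<open>S\<close> and \<open>u = g\<close> on the boundary.\<close>

definition is_solution :: "((nat \<Rightarrow> real) \<Rightarrow> real) \<Rightarrow> nat \<Rightarrow> (nat \<Rightarrow> 'a) \<Rightarrow> (real^'n::finite) set \<Rightarrow>
    (real^'n \<Rightarrow> real) \<Rightarrow> (real^'n \<Rightarrow> 'a \<Rightarrow> real^'n) \<Rightarrow> (real^'n \<Rightarrow> 'a \<Rightarrow> real^'n^'n) \<Rightarrow>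
    (real^'n \<Rightarrow> 'a \<Rightarrow> real) \<Rightarrow> (real^'n \<Rightarrow> 'a \<Rightarrow> real) \<Rightarrow> (real^'n \<Rightarrow> real) \<Rightarrow> bool" where
  "is_solution F K a S g b \<sigma> c f u \<longleftrightarrow>
     continuous_on (closure S) u \<and> C_class 2 S u
     \<and> (\<forall>x\<in>S. F (RK_vec K (\<lambda>k. L_op a b \<sigma> c k u x + f x (a k))) = 0)
     \<and> (\<forall>x\<in>frontier S. u x = g x)"


section \<open>The regularity constant\<close>

definition sigma_bound :: "nat \<Rightarrow> (nat \<Rightarrow> 'a) \<Rightarrow> (real^'n::finite) set \<Rightarrow>
    (real^'n \<Rightarrow> 'a \<Rightarrow> real^'n^'n) \<Rightarrow> real" where
  "sigma_bound K a S \<sigma> =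
     enn2real (SUP k\<in>{1..K}. SUP i. SUP j. sup_norm (closure S) (\<lambda>x. \<sigma> x (a k) $ i $ j))"

text \<open>\<open>\<beta>0\<close> is a function of \<open>\<nu>\<close> and \<open>M\<close>, and the dimension is fixed by the type \<open>'n\<close>.  The control
  set only labels the coefficients, so here it may be taken to consist of natural numbers;
  \<open>K\<close> and all coefficients are quantified after \<open>\<beta>0\<close>, and the constant \<open>C\<close> is
  chosen before everything except \<open>\<nu>\<close>, \<open>\<Lambda>\<close>, \<open>\<beta>\<close> and \<open>S\<close>.  Uniqueness is meant on the closure
  of \<open>S\<close>, since the values elsewhere are irrelevant.\<close>

definition regularity_constant :: "'n::finite itself \<Rightarrow> (real \<Rightarrow> real \<Rightarrow> real) \<Rightarrow> bool" where
  "regularity_constant TN \<beta>0 \<longleftrightarrow>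
     (\<forall>\<nu>>0. \<forall>M>0. 0 < \<beta>0 \<nu> M \<and> \<beta>0 \<nu> M < 1)
   \<and> (\<forall>K (a :: nat \<Rightarrow> nat) A (S :: (real^'n) set) \<nu> \<Lambda> \<theta> g b \<sigma> c f H c0 \<rho> \<epsilon>.
        H1 K a A S \<nu> \<Lambda> \<theta> g b \<sigma> c f \<and> H2 K H c0 \<rho> \<and> \<epsilon> > 0 \<longrightarrow>
        (\<exists>u. is_solution (H_eps H \<epsilon>) K a S g b \<sigma> c f u
           \<and> (\<forall>v. is_solution (H_eps H \<epsilon>) K a S g b \<sigma> c f v \<longrightarrow> (\<forall>x\<in>closure S. v x = u x))
           \<and> u \<in> holder_space 2 (min (\<beta>0 \<nu> (sigma_bound K a S \<sigma>)) \<theta>) S))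
   \<and> (\<forall>\<nu> \<Lambda> \<beta> (S :: (real^'n) set). \<exists>C\<ge>0.
        \<forall>K (a :: nat \<Rightarrow> nat) A \<theta> g b \<sigma> c f H c0 \<rho> \<epsilon> u.
          H1 K a A S \<nu> \<Lambda> \<theta> g b \<sigma> c f \<and> H2 K H c0 \<rho> \<and> \<epsilon> > 0
          \<and> 0 < \<beta> \<and> \<beta> \<le> min (\<beta>0 \<nu> (sigma_bound K a S \<sigma>)) \<theta>
          \<and> is_solution (H_eps H \<epsilon>) K a S g b \<sigma> c f u \<and> u \<in> holder_space 2 \<beta> S \<longrightarrow>
          holder_norm 2 \<beta> S u \<le> ennreal C * (holder_norm 2 \<beta> S g + ennreal (\<epsilon> * c0) + 1))"

end

theory Submission
  imports Defs "HOL-Complex_Analysis.Great_Picard"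
begin

text \<open>Two things about \<open>H\<close> are used: it is convex and it stays within a bounded distance of the maximum.
A convex function of one variable that is bounded above on a half line is monotone there, and one
that is bounded on a line is constant; applied along suitable rays this shows that \<open>H\<close> does not
decrease if every argument increases, and that adding \<open>d\<close> to all arguments adds \<open>d\<close> to the value.
This property, called shift monotone below, passes to all \<open>H\<^sub>\<epsilon>\<close>, holds for the maximum
\<open>H\<^sub>0\<close> itself, and implies that \<open>H\<^sub>\<epsilon>\<close> increases with \<open>\<epsilon>\<close>, while
\<open>H\<^sub>0 \<le> H\<^sub>\<epsilon> \<le> H\<^sub>0 + \<epsilon>c\<^sub>0\<close> is immediate from the bounds on \<open>H\<close>.

For a shift monotone \<open>F\<close> the operator \<open>F(\<^bold>Lu + \<^bold>f)\<close> obeys a quantitative comparison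
principle (\<open>comparison_principle\<close>): a defect of size \<open>\<kappa>\<close> in the equation moves the
solution by at most \<open>(exp(\<alpha> diam S) - 1) 2\<kappa>/\<nu>\<close>. The barrier is the classical
\<open>exp(\<alpha>d) - exp(\<alpha>(x\<^sub>l - m))\<close>, where \<open>\<alpha>\<close> is so large that the second order term
beats the drift. Used with \<open>F = H\<^sub>\<epsilon>\<close> and \<open>\<kappa> = 0\<close> this gives the monotonicity in
\<open>\<epsilon>\<close> and \<open>u \<le> u\<^sup>\<epsilon>\<close>; used with \<open>F = H\<^sub>0\<close> and \<open>\<kappa> = \<epsilon>c\<^sub>0\<close> it
gives the upper estimate.

The convergence in \<open>C\<^bsup>2,\<beta>\<^esup>\<close> is a compactness argument (\<open>holder_compactness\<close>). The property of
\<open>\<beta>\<^sub>0\<close> bounds \<open>u\<^sup>\<epsilon>\<close> in \<open>C\<^bsup>2,\<beta>'\<^esup>\<close>, \<open>\<beta>' = min(\<beta>\<^sub>0, \<theta>)\<close>, uniformly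
for bounded \<open>\<epsilon>\<close>, and the estimate just obtained yields uniform convergence \<open>u\<^sup>\<epsilon> \<rightarrow> u\<close>.
By Arzela--Ascoli every sequence of first or second derivatives has uniformly convergent
subsequences; their limits can only be the derivatives of \<open>u\<close>, so the whole family
converges, and \<open>\<beta> < \<beta>'\<close> together with interpolation upgrades uniform convergence of
the second derivatives to convergence in the Hoelder seminorm.

Arzela--Ascoli needs equicontinuity on the closure of \<open>S\<close>. For second derivatives this is the Hoelder bound.
For first derivatives a bound on the second derivatives controls oscillation only along curves
inside \<open>S\<close>, and this is where the smoothness of the boundary enters: in a chart that flattens the
boundary any two points near the boundary are joined by a segment inside a half ball
(\<open>equicontinuous_frontier\<close>).\<close>


section \<open>Smooth approximations of the maximum\<close>

text \<open>This single condition combines monotonicity in every argument (\<open>d = 0\<close>) with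
compatibility with adding the same constant to all arguments. It is exactly what the comparison
principle needs: if every \<open>\<L>\<^sub>k\<close> drops by \<open>d\<close>, the nonlinear operator drops by at least \<open>d\<close>.\<close>

definition shift_monotone :: "nat \<Rightarrow> ((nat \<Rightarrow> real) \<Rightarrow> real) \<Rightarrow> bool" where
  "shift_monotone K F \<longleftrightarrow> (\<forall>x\<in>RK K. \<forall>y\<in>RK K. \<forall>d.
     (\<forall>k\<in>{1..K}. x k + d \<le> y k) \<longrightarrow> F x + d \<le> F y)"

lemma shift_monotone_H_zero:
  assumes "K \<ge> 1" shows "shift_monotone K (H_zero K)"
  unfolding shift_monotone_def H_zero_def
proof (intro ballI allI impI)
  fix x y :: "nat \<Rightarrow> real" and d
  assume le: "\<forall>k\<in>{1..K}. x k + d \<le> y k"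
  have "Max (x ` {1..K}) \<le> Max (y ` {1..K}) - d"
  proof (rule Max.boundedI)
    fix r assume "r \<in> x ` {1..K}"
    then obtain k where k: "k \<in> {1..K}" "r = x k" by auto
    have "y k \<le> Max (y ` {1..K})" using k(1) by (intro Max_ge) auto
    then show "r \<le> Max (y ` {1..K}) - d" using bspec[OF le k(1)] k(2) by linarith
  qed (use assms in auto)
  then show "Max (x ` {1..K}) + d \<le> Max (y ` {1..K})" by simp
qed

text \<open>Follow the ray from \<open>y\<close> through \<open>x\<close> to the point \<open>z = x + T(x - y)\<close>. There every coordinate is at
most \<open>max x - Td\<close>, so \<open>H z\<close> is at most \<open>max x - Td + c\<^sub>0\<close>; since \<open>x\<close> lies between \<open>z\<close> and \<open>y\<close>,
convexity gives \<open>T(H x + d - H y) \<le> max x + c\<^sub>0 - H x\<close>. The right-hand side does not depend on \<open>T\<close>.\<close>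

lemma shift_monotone_H:
  assumes "K \<ge> 1" and conv: "RK_convex K H"
    and upper: "\<forall>x\<in>RK K. H x \<le> Max (x ` {1..K}) + c0"
  shows "shift_monotone K H"
  unfolding shift_monotone_def
proof (intro ballI allI impI)
  fix x y :: "nat \<Rightarrow> real" and d
  assume x: "x \<in> RK K" and y: "y \<in> RK K" and le: "\<forall>k\<in>{1..K}. x k + d \<le> y k"
  have bound: "T * (H x + d - H y) \<le> Max (x ` {1..K}) + c0 - H x" if T: "T \<ge> 0" for T
  proof -
    define z where "z = (\<lambda>k. x k + T * (x k - y k))"
    have z: "z \<in> RK K" using x y by (auto simp: RK_def z_def)
    have l: "1 / (1 + T) + 1 / (1 + T) * T = 1" using T by (simp add: field_simps)
    have "(1 - r) * y k + r * z k = y k + (r + r * T) * (x k - y k)" for k r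
      by (simp add: z_def algebra_simps)
    note e = this
    have eq: "(\<lambda>k. (1 - 1 / (1 + T)) * y k + 1 / (1 + T) * z k) = x"
      unfolding e[of "1 / (1 + T)"] l by (simp add: fun_eq_iff)
    have "1 / (1 + T) \<in> {0..1}" using T by auto
    then have "H x \<le> (1 - 1 / (1 + T)) * H y + 1 / (1 + T) * H z"
      using conv[unfolded RK_convex_def, rule_format, OF y z, of "1 / (1 + T)"] unfolding eq by blast
    then have "(1 + T) * H x \<le> (1 + T) * ((1 - 1 / (1 + T)) * H y + 1 / (1 + T) * H z)"
      using T by (intro mult_left_mono) auto
    also have "\<dots> = T * H y + H z"
    proof -
      have "(1 + T) * ((1 - r) * H y + r * H z) = (1 + T) * H y + (r + r * T) * (H z - H y)" for r
        by (simp add: algebra_simps)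
      from this[of "1 / (1 + T)"] show ?thesis unfolding l by (simp add: algebra_simps)
    qed
    finally have 1: "(1 + T) * H x \<le> T * H y + H z" .
    have "Max (z ` {1..K}) \<le> Max (x ` {1..K}) - T * d"
    proof (rule Max.boundedI)
      fix r assume "r \<in> z ` {1..K}"
      then obtain k where k: "k \<in> {1..K}" "r = z k" by auto
      have "x k \<le> Max (x ` {1..K})" using k(1) by (intro Max_ge) auto
      moreover have "x k - y k \<le> - d" using le k by fastforce
      then have "T * (x k - y k) \<le> T * (- d)" using T by (rule mult_left_mono)
      then have "T * (x k - y k) \<le> - (T * d)" by simp
      ultimately show "r \<le> Max (x ` {1..K}) - T * d" unfolding k(2) z_def by linarith
    qed (use assms in auto)
    with upper z have "H z \<le> Max (x ` {1..K}) - T * d + c0" by fastforce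
    with 1 show ?thesis by (simp add: algebra_simps)
  qed
  show "H x + d \<le> H y"
  proof (rule ccontr)
    assume "\<not> ?thesis"
    then have pos: "H x + d - H y > 0" by simp
    obtain N :: nat where "Max (x ` {1..K}) + c0 - H x < real N * (H x + d - H y)"
      using reals_Archimedean3[OF pos] by blast
    then show False using bound[of "real N"] by simp
  qed
qed

lemma RK_scale: "x \<in> RK K \<Longrightarrow> (\<lambda>k. x k / e) \<in> RK K"
  by (auto simp: RK_def)

lemma shift_monotone_H_eps:
  assumes "shift_monotone K H" "e > 0" shows "shift_monotone K (H_eps H e)"
  unfolding shift_monotone_def
proof (intro ballI allI impI)
  fix x y :: "nat \<Rightarrow> real" and d
  assume x: "x \<in> RK K" and y: "y \<in> RK K" and le: "\<forall>k\<in>{1..K}. x k + d \<le> y k"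
  have "H (\<lambda>k. x k / e) + d / e \<le> H (\<lambda>k. y k / e)"
    using assms(1)[unfolded shift_monotone_def, rule_format, OF RK_scale[OF x, of e] RK_scale[OF y, of e], of "d / e"]
      le assms(2) by (simp add: divide_right_mono flip: add_divide_distrib)
  then have "e * (H (\<lambda>k. x k / e) + d / e) \<le> e * H (\<lambda>k. y k / e)"
    using assms(2) by simp
  then show "H_eps H e x + d \<le> H_eps H e y" using assms(2) by (simp add: H_eps_def algebra_simps)
qed

lemma Max_scale:
  fixes x :: "nat \<Rightarrow> real"
  assumes "K \<ge> 1" "e > 0"
  shows "e * Max ((\<lambda>k. x k / e) ` {1..K}) = Max (x ` {1..K})"
proof -
  have "mono (\<lambda>r::real. e * r)" using assms by (auto intro!: monoI)
  then have "e * Max ((\<lambda>k. x k / e) ` {1..K}) = Max ((\<lambda>r. e * r) ` ((\<lambda>k. x k / e) ` {1..K}))"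
    using assms by (intro mono_Max_commute) auto
  also have "\<dots> = Max (x ` {1..K})" using assms by (simp add: image_image)
  finally show ?thesis .
qed

lemma H_eps_bounds:
  assumes "K \<ge> 1" "e > 0" "x \<in> RK K"
    and "\<forall>x\<in>RK K. H x - c0 \<le> Max (x ` {1..K}) \<and> Max (x ` {1..K}) \<le> H x"
  shows "H_zero K x \<le> H_eps H e x" "H_eps H e x \<le> H_zero K x + e * c0"
proof -
  let ?m = "Max ((\<lambda>k. x k / e) ` {1..K})"
  have "H (\<lambda>k. x k / e) - c0 \<le> ?m" "?m \<le> H (\<lambda>k. x k / e)"
    using assms(4) RK_scale[OF assms(3)] by blast+
  then have "e * (H (\<lambda>k. x k / e) - c0) \<le> e * ?m" "e * ?m \<le> e * H (\<lambda>k. x k / e)"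
    using assms(2) by simp_all
  then show "H_zero K x \<le> H_eps H e x" "H_eps H e x \<le> H_zero K x + e * c0"
    using Max_scale[OF assms(1,2), of x] by (simp_all add: H_zero_def H_eps_def algebra_simps)
qed

text \<open>With \<open>z = x / \<epsilon>\<^sub>2\<close>, \<open>t = \<epsilon>\<^sub>2 / \<epsilon>\<^sub>1\<close> and \<open>m = max z\<close> the claim is \<open>t H(z) \<le> H(tz)\<close>. Shrinking
\<open>z\<close> to \<open>tz\<close> lowers no coordinate by more than \<open>(1 - t)m\<close>, so shift monotonicity gives
\<open>H(tz) \<ge> H(z) - (1 - t)m\<close>, and \<open>m \<le> H(z)\<close>.\<close>

lemma H_eps_mono:
  assumes "K \<ge> 1" "0 < e2" "e2 \<le> e1" "x \<in> RK K" and sm: "shift_monotone K H"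
    and lower: "\<forall>x\<in>RK K. Max (x ` {1..K}) \<le> H x"
  shows "H_eps H e2 x \<le> H_eps H e1 x"
proof -
  define z where "z = (\<lambda>k. x k / e2)"
  define t where "t = e2 / e1"
  define m where "m = Max (z ` {1..K})"
  have z: "z \<in> RK K" using RK_scale[OF assms(4)] by (simp add: z_def)
  have t: "0 < t" "t \<le> 1" using assms by (auto simp: t_def)
  have tz: "(\<lambda>k. x k / e1) = (\<lambda>k. t * z k)" using assms by (auto simp: z_def t_def)
  then have tzR: "(\<lambda>k. t * z k) \<in> RK K" using RK_scale[OF assms(4), of e1] by simp
  have "H z + - ((1 - t) * m) \<le> H (\<lambda>k. t * z k)"
  proof (rule sm[unfolded shift_monotone_def, rule_format, OF z tzR])
    fix k assume "k \<in> {1..K}"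
    then have "z k \<le> m" unfolding m_def by (intro Max_ge) auto
    then have "(1 - t) * z k \<le> (1 - t) * m" using t by (intro mult_left_mono) auto
    then show "z k + - ((1 - t) * m) \<le> t * z k" by (simp add: algebra_simps)
  qed
  moreover have "m \<le> H z" using lower z by (simp add: m_def)
  then have "(1 - t) * m \<le> (1 - t) * H z" using t by (intro mult_left_mono) auto
  ultimately have "t * H z \<le> H (\<lambda>k. t * z k)" by (simp add: algebra_simps)
  then have "e1 * (t * H z) \<le> e1 * H (\<lambda>k. t * z k)" using assms by simp
  moreover have "e1 * t = e2" using assms by (simp add: t_def)
  ultimately show ?thesis unfolding H_eps_def tz
    by (simp add: z_def mult.assoc [symmetric])
qed


section \<open>The comparison principle\<close>

lemma frechet_derivative_eq_sum_pd:
  assumes "\<phi> differentiable (at x)"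
  shows "frechet_derivative \<phi> (at x) h = (\<Sum>i\<in>UNIV. h $ i * pd i \<phi> x)"
proof -
  have lin: "linear (frechet_derivative \<phi> (at x))" using assms linear_frechet_derivative by blast
  have "frechet_derivative \<phi> (at x) h = frechet_derivative \<phi> (at x) (\<Sum>i\<in>UNIV. h $ i *\<^sub>R axis i 1)"
    by (simp add: basis_expansion scalar_mult_eq_scaleR[symmetric])
  also have "\<dots> = (\<Sum>i\<in>UNIV. h $ i * pd i \<phi> x)"
    by (simp add: linear_sum[OF lin] linear_scale[OF lin] pd_def)
  finally show ?thesis .
qed

lemma DERIV_along_line:
  assumes "\<phi> differentiable (at (x + t *\<^sub>R h))"
  shows "((\<lambda>s. \<phi> (x + s *\<^sub>R h)) has_real_derivative
            (\<Sum>i\<in>UNIV. h $ i * pd i \<phi> (x + t *\<^sub>R h))) (at t)"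
proof -
  let ?D = "frechet_derivative \<phi> (at (x + t *\<^sub>R h))"
  have 1: "(\<phi> has_derivative ?D) (at (x + t *\<^sub>R h))" using assms frechet_derivative_works by blast
  have 2: "((\<lambda>s. x + s *\<^sub>R h) has_derivative (\<lambda>s. s *\<^sub>R h)) (at t)"
    by (auto intro!: derivative_eq_intros)
  have "((\<lambda>s. \<phi> (x + s *\<^sub>R h)) has_derivative (\<lambda>s. ?D (s *\<^sub>R h))) (at t)"
    using diff_chain_at[OF 2 1] by (simp add: o_def)
  moreover have "?D (s *\<^sub>R h) = (\<Sum>i\<in>UNIV. h $ i * pd i \<phi> (x + t *\<^sub>R h)) * s" for s
    by (simp add: frechet_derivative_eq_sum_pd[OF assms] sum_distrib_left mult_ac)
  ultimately show ?thesis by (simp add: has_field_derivative_def)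
qed

lemma C_class_2:
  "C_class 2 S \<phi> \<longleftrightarrow> (\<forall>x\<in>S. \<phi> differentiable (at x))
     \<and> (\<forall>i. \<forall>x\<in>S. pd i \<phi> differentiable (at x))
     \<and> (\<forall>i j. continuous_on S (pd j (pd i \<phi>)))"
  by (auto simp: numeral_2_eq_2)

text \<open>If the second derivative were positive, \<open>h'\<close> would be positive immediately to the right of \<open>0\<close>
and \<open>h\<close> would increase there.\<close>

lemma second_derivative_test:
  fixes h h' :: "real \<Rightarrow> real"
  assumes "r > 0" and h: "\<And>t. \<bar>t\<bar> < r \<Longrightarrow> (h has_real_derivative h' t) (at t)"
    and h2: "(h' has_real_derivative h2) (at 0)"
    and max: "\<And>t. \<bar>t\<bar> < r \<Longrightarrow> h t \<le> h 0"
  shows "h' 0 = 0" "h2 \<le> 0"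
proof -
  show 0: "h' 0 = 0"
    using DERIV_local_max[of h "h' 0" 0 r] h[of 0] max assms(1) by simp
  show "h2 \<le> 0"
  proof (rule ccontr)
    assume "\<not> h2 \<le> 0"
    then obtain d where d: "d > 0" "\<And>s. 0 < s \<Longrightarrow> s < d \<Longrightarrow> h' 0 < h' s"
      using DERIV_pos_inc_right[OF h2] by auto
    define t where "t = min d r / 2"
    have t: "0 < t" "t < d" "t < r" using d assms(1) by (auto simp: t_def)
    have "\<exists>s. 0 < s \<and> s < t \<and> h t - h 0 = (t - 0) * h' s"
      using t by (intro MVT2 h) auto
    then obtain s where s: "0 < s" "s < t" "h t - h 0 = t * h' s" by auto
    have "h' s > 0" using d(2)[of s] s t 0 by auto
    then have "h t > h 0" using s t by (metis diff_gt_0_iff_gt mult_pos_pos)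
    then show False using max[of t] t by auto
  qed
qed

text \<open>The one-dimensional test is applied along the line with direction \<open>\<xi>\<close> through the maximum point.
Working with all directions \<open>\<xi>\<close> avoids the spectral theorem: the second order part of \<open>\<L>\<^sub>k\<close> is a sum
of second derivatives in the directions of the columns of \<open>\<sigma>\<^sub>k\<close>, so no order of differentiation
has to be exchanged and no Hessian has to be diagonalised.\<close>

lemma second_order_conditions_at_max:
  fixes u v :: "real^'n::finite \<Rightarrow> real"
  assumes "open S" "x0 \<in> S" "C_class 2 S u" "C_class 2 S v"
    and max: "\<And>x. x \<in> S \<Longrightarrow> v x - u x - (E - \<kappa> * exp (\<alpha> * (x $ l - m)))
                 \<le> v x0 - u x0 - (E - \<kappa> * exp (\<alpha> * (x0 $ l - m)))"
  defines "E0 \<equiv> \<kappa> * exp (\<alpha> * (x0 $ l - m))"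
  shows "(\<Sum>i\<in>UNIV. \<xi> $ i * (pd i v x0 - pd i u x0)) + \<xi> $ l * \<alpha> * E0 = 0"
    and "(\<Sum>i\<in>UNIV. \<Sum>j\<in>UNIV. \<xi> $ i * \<xi> $ j * (pd i (pd j v) x0 - pd i (pd j u) x0))
           + (\<xi> $ l)\<^sup>2 * \<alpha>\<^sup>2 * E0 \<le> 0"
proof -
  obtain r0 where r0: "r0 > 0" "ball x0 r0 \<subseteq> S" using assms(1,2) open_contains_ball by blast
  define r where "r = r0 / (norm \<xi> + 1)"
  have "norm \<xi> + 1 > 0" by (simp add: add_nonneg_pos)
  then have r: "r > 0" using r0 by (simp add: r_def)
  have inS: "x0 + t *\<^sub>R \<xi> \<in> S" if "\<bar>t\<bar> < r" for t
  proof -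
    have "\<bar>t\<bar> * norm \<xi> \<le> \<bar>t\<bar> * (norm \<xi> + 1)" by (intro mult_left_mono) auto
    also have "\<dots> < r0" using that \<open>norm \<xi> + 1 > 0\<close> by (simp add: r_def pos_less_divide_eq)
    finally have "x0 + t *\<^sub>R \<xi> \<in> ball x0 r0" by (simp add: dist_norm)
    then show ?thesis using r0 by blast
  qed
  define h where "h = (\<lambda>t. v (x0 + t *\<^sub>R \<xi>) - u (x0 + t *\<^sub>R \<xi>)
     - (E - \<kappa> * exp (\<alpha> * ((x0 + t *\<^sub>R \<xi>) $ l - m))))"
  define h' where "h' = (\<lambda>t. (\<Sum>i\<in>UNIV. \<xi> $ i * pd i v (x0 + t *\<^sub>R \<xi>))
     - (\<Sum>i\<in>UNIV. \<xi> $ i * pd i u (x0 + t *\<^sub>R \<xi>))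
     + \<kappa> * (exp (\<alpha> * ((x0 + t *\<^sub>R \<xi>) $ l - m)) * (\<alpha> * \<xi> $ l)))"
  have dh: "(h has_real_derivative h' t) (at t)" if "\<bar>t\<bar> < r" for t
    unfolding h_def h'_def
    using inS[OF that] assms(3,4)
    by (auto simp: C_class_2 intro!: derivative_eq_intros DERIV_along_line)
  have dh': "(h' has_real_derivative
      ((\<Sum>i\<in>UNIV. (\<Sum>j\<in>UNIV. \<xi> $ j * pd j (pd i v) (x0 + 0 *\<^sub>R \<xi>)) * \<xi> $ i)
      - (\<Sum>i\<in>UNIV. (\<Sum>j\<in>UNIV. \<xi> $ j * pd j (pd i u) (x0 + 0 *\<^sub>R \<xi>)) * \<xi> $ i)
      + \<kappa> * (exp (\<alpha> * ((x0 + 0 *\<^sub>R \<xi>) $ l - m)) * (\<alpha> * \<xi> $ l) * (\<alpha> * \<xi> $ l)))) (at 0)"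
    unfolding h'_def
    using inS[of 0] r assms(3,4)
    by (auto simp: C_class_2 intro!: derivative_eq_intros DERIV_along_line sum.cong)
  have mx: "h t \<le> h 0" if "\<bar>t\<bar> < r" for t
    using max[OF inS[OF that]] by (simp add: h_def)
  note T = second_derivative_test[OF r dh dh' mx]
  show "(\<Sum>i\<in>UNIV. \<xi> $ i * (pd i v x0 - pd i u x0)) + \<xi> $ l * \<alpha> * E0 = 0"
    using T(1) by (simp add: h'_def E0_def sum_subtractf algebra_simps)
  have sw: "(\<Sum>i\<in>UNIV. (\<Sum>j\<in>UNIV. \<xi> $ j * q j i) * \<xi> $ i) = (\<Sum>i\<in>UNIV. \<Sum>j\<in>UNIV. \<xi> $ i * \<xi> $ j * q i j)"
    for q :: "'n \<Rightarrow> 'n \<Rightarrow> real"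
  proof -
    have "(\<Sum>i\<in>UNIV. \<Sum>j\<in>UNIV. \<xi> $ i * \<xi> $ j * q i j) = (\<Sum>j\<in>UNIV. \<Sum>i\<in>UNIV. \<xi> $ i * \<xi> $ j * q i j)"
      by (rule sum.swap)
    then show ?thesis by (simp add: sum_distrib_left mult_ac)
  qed
  show "(\<Sum>i\<in>UNIV. \<Sum>j\<in>UNIV. \<xi> $ i * \<xi> $ j * (pd i (pd j v) x0 - pd i (pd j u) x0))
           + (\<xi> $ l)\<^sup>2 * \<alpha>\<^sup>2 * E0 \<le> 0"
    using T(2) unfolding sw
    by (simp add: E0_def sum_subtractf right_diff_distrib power2_eq_square mult_ac)
qed

lemma sum_axis_mult: "(\<Sum>i\<in>UNIV. axis l 1 $ i * q i) = (q l :: real)"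
proof -
  have "(\<Sum>i\<in>UNIV. axis l 1 $ i * q i) = (\<Sum>i\<in>UNIV. if i = l then q i else 0)"
    by (intro sum.cong) (auto simp: axis_def)
  then show ?thesis by simp
qed

text \<open>At an interior maximum of \<open>v - u - V\<close>, where \<open>V\<close> is the barrier, the first and second derivatives of \<open>v - u\<close> are controlled
by those of \<open>V\<close>, and \<open>V\<close> was chosen with \<open>a\<^sub>l\<^sub>l \<alpha>\<^sup>2 - B\<alpha> \<ge> \<alpha>(\<alpha>\<nu>/2 - B) = \<alpha>\<nu>/2\<close>;
the last equality is the definition of \<open>\<alpha>\<close>. The zeroth order term has the right sign because
\<open>v \<ge> u\<close> at that point.\<close>

lemma L_op_less_at_max:
  fixes u v :: "real^'n::finite \<Rightarrow> real"
  assumes "open S" "x0 \<in> S" "C_class 2 S u" "C_class 2 S v"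
    and max: "\<And>x. x \<in> S \<Longrightarrow> v x - u x - (E - \<kappa> * exp (\<alpha> * (x $ l - m)))
                 \<le> v x0 - u x0 - (E - \<kappa> * exp (\<alpha> * (x0 $ l - m)))"
    and pos: "v x0 \<ge> u x0" "\<kappa> \<ge> 0" "x0 $ l \<ge> m"
    and c: "0 \<le> c x0 (a k)" and b: "\<bar>b x0 (a k) $ l\<bar> \<le> B" and "B \<ge> 0" "\<nu> > 0"
    and ell: "\<And>\<xi>. \<xi> \<bullet> ((\<sigma> x0 (a k) ** transpose (\<sigma> x0 (a k))) *v \<xi>) \<ge> \<nu> * (\<xi> \<bullet> \<xi>)"
    and \<alpha>: "\<alpha> = B / (\<nu> / 2) + 1"
  shows "L_op a b \<sigma> c k v x0 + \<kappa> * \<nu> / 2 \<le> L_op a b \<sigma> c k u x0"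
proof -
  define E0 where "E0 = \<kappa> * exp (\<alpha> * (x0 $ l - m))"
  define q where "q = (\<lambda>i j. pd i (pd j v) x0 - pd i (pd j u) x0)"
  define s where "s = \<sigma> x0 (a k)"
  note cond = second_order_conditions_at_max[OF assms(1-4) max, folded E0_def]
  have \<alpha>1: "\<alpha> \<ge> 1" using assms by simp
  have "exp (\<alpha> * (x0 $ l - m)) \<ge> 1" using \<alpha>1 pos by simp
  then have E0: "E0 \<ge> \<kappa>" using mult_left_mono[OF _ pos(2), of 1] by (simp add: E0_def)
  have first: "pd i v x0 - pd i u x0 = (if i = l then - \<alpha> * E0 else 0)" for i
    using cond(1)[of "axis i 1"] by (simp add: sum_axis_mult) (simp add: axis_def split: if_splits)
  have b1: "(\<Sum>i\<in>UNIV. b x0 (a k) $ i * (pd i v x0 - pd i u x0)) = - (b x0 (a k) $ l * \<alpha> * E0)"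
    by (simp add: first if_distrib cong: if_cong)
  have col: "(\<Sum>i\<in>UNIV. \<Sum>j\<in>UNIV. s $ i $ r * s $ j $ r * q i j) \<le> - ((s $ l $ r)\<^sup>2 * \<alpha>\<^sup>2 * E0)" for r
    using cond(2)[of "column r s"] by (simp add: q_def column_def)
  have ass: "(s ** transpose s) $ i $ j = (\<Sum>r\<in>UNIV. s $ i $ r * s $ j $ r)" for i j
    by (simp add: matrix_matrix_mult_def transpose_def)
  have "(\<Sum>i\<in>UNIV. \<Sum>j\<in>UNIV. (s ** transpose s) $ i $ j * q i j)
      = (\<Sum>i\<in>UNIV. \<Sum>j\<in>UNIV. \<Sum>r\<in>UNIV. s $ i $ r * s $ j $ r * q i j)"
    by (simp add: ass sum_distrib_right)
  also have "\<dots> = (\<Sum>i\<in>UNIV. \<Sum>r\<in>UNIV. \<Sum>j\<in>UNIV. s $ i $ r * s $ j $ r * q i j)"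
    by (intro sum.cong sum.swap refl)
  also have "\<dots> = (\<Sum>r\<in>UNIV. \<Sum>i\<in>UNIV. \<Sum>j\<in>UNIV. s $ i $ r * s $ j $ r * q i j)"
    by (rule sum.swap)
  also have "\<dots> \<le> (\<Sum>r\<in>UNIV. - ((s $ l $ r)\<^sup>2 * \<alpha>\<^sup>2 * E0))" by (intro sum_mono col)
  also have "\<dots> = - ((\<Sum>r\<in>UNIV. (s $ l $ r)\<^sup>2) * (\<alpha>\<^sup>2 * E0))"
    by (simp add: sum_negf sum_distrib_right mult.assoc)
  also have "\<dots> \<le> - (\<nu> * (\<alpha>\<^sup>2 * E0))"
  proof -
    have "\<nu> \<le> (\<Sum>r\<in>UNIV. (s $ l $ r)\<^sup>2)"
    proof -
      have "axis l 1 \<bullet> ((s ** transpose s) *v axis l 1) = (s ** transpose s) $ l $ l"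
        by (simp add: matrix_vector_mul_component inner_axis inner_axis' )
      then show ?thesis using ell[of "axis l 1", folded s_def] 
        by (simp add: ass power2_eq_square inner_axis)
    qed
    then show ?thesis using E0 pos by (simp add: mult_right_mono)
  qed
  finally have main: "(\<Sum>i\<in>UNIV. \<Sum>j\<in>UNIV. (s ** transpose s) $ i $ j * q i j) \<le> - (\<nu> * (\<alpha>\<^sup>2 * E0))" .
  have half: "(\<Sum>i\<in>UNIV. \<Sum>j\<in>UNIV. ((1/2) *\<^sub>R (s ** transpose s)) $ i $ j * p i j)
      = (\<Sum>i\<in>UNIV. \<Sum>j\<in>UNIV. (s ** transpose s) $ i $ j * p i j) / 2" for p :: "'n \<Rightarrow> 'n \<Rightarrow> real"
    by (simp add: sum_divide_distrib)
  have Leq: "L_op a b \<sigma> c k v x0 - L_op a b \<sigma> c k u x0 =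
      (\<Sum>i\<in>UNIV. \<Sum>j\<in>UNIV. (s ** transpose s) $ i $ j * q i j) / 2
      + (\<Sum>i\<in>UNIV. b x0 (a k) $ i * (pd i v x0 - pd i u x0)) - c x0 (a k) * (v x0 - u x0)"
    unfolding L_op_def s_def[symmetric] half q_def
    by (simp add: sum_subtractf right_diff_distrib) 
  also have "\<dots> \<le> - (\<nu> * (\<alpha>\<^sup>2 * E0)) / 2 - b x0 (a k) $ l * \<alpha> * E0"
    using main b1 mult_nonneg_nonneg[OF c, of "v x0 - u x0"] pos by simp
  also have "\<dots> \<le> - (\<kappa> * \<nu> / 2)"
  proof -
    have "- B \<le> b x0 (a k) $ l" using b by simp
    then have "(- B) * (\<alpha> * E0) \<le> b x0 (a k) $ l * (\<alpha> * E0)"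
      using \<alpha>1 E0 pos by (intro mult_right_mono) auto
    moreover have B: "B = (\<alpha> - 1) * \<nu> / 2" using \<alpha> \<open>\<nu> > 0\<close> by simp
    have "B * (\<alpha> * E0) = \<nu> * (\<alpha>\<^sup>2 * E0) / 2 - \<alpha> * (\<nu> * E0 / 2)"
      unfolding B by (simp add: field_simps power2_eq_square)
    ultimately have "- (\<nu> * (\<alpha>\<^sup>2 * E0)) / 2 - b x0 (a k) $ l * \<alpha> * E0 \<le> - (\<alpha> * (\<nu> * E0 / 2))"
      unfolding mult.assoc[of "b x0 (a k) $ l"] minus_mult_left[symmetric] by linarith
    moreover have "1 * (\<nu> * \<kappa> / 2) \<le> \<alpha> * (\<nu> * E0 / 2)"
      using \<alpha>1 E0 pos \<open>\<nu> > 0\<close> by (intro mult_mono) auto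
    ultimately show ?thesis by (simp add: mult.commute[of \<nu> \<kappa>])
  qed
  finally show ?thesis by simp
qed

lemma closure_in_coordinate_slab:
  fixes S :: "(real^'n::finite) set"
  assumes "bounded S"
  obtains m where "\<And>x. x \<in> closure S \<Longrightarrow> m \<le> x $ l \<and> x $ l \<le> m + diameter S"
proof (cases "S = {}")
  case False
  have "compact (closure S)" using assms by simp
  moreover have "continuous_on (closure S) (\<lambda>x. x $ l)" by (intro continuous_intros)
  ultimately obtain p where p: "p \<in> closure S" "\<And>x. x \<in> closure S \<Longrightarrow> p $ l \<le> x $ l"
    using continuous_attains_inf[of "closure S" "\<lambda>x. x $ l"] False by auto
  have "x $ l \<le> p $ l + diameter S" if "x \<in> closure S" for x
  proof -
    have "x $ l - p $ l \<le> dist x p" using component_le_norm_cart[of "x - p" l] by (simp add: dist_norm)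
    also have "\<dots> \<le> diameter (closure S)"
      using diameter_bounded_bound[OF bounded_closure[OF assms]] that p by blast
    finally show ?thesis by (simp add: diameter_closure[OF assms])
  qed
  with p that show ?thesis by blast
qed (use that in auto)

text \<open>Let \<open>V\<close> be the barrier for the defect \<open>\<kappa> + \<eta>\<close> with \<open>\<eta> > 0\<close>. If \<open>v - u - V\<close> had a positive
maximum, it would be attained inside \<open>S\<close>, where every \<open>\<L>\<^sub>k v\<close> would be below \<open>\<L>\<^sub>k u\<close> by at
least \<open>\<kappa> + \<eta>\<close>; shift monotonicity carries this over to \<open>F\<close> and contradicts the
hypothesis, which allows a defect of \<open>\<kappa>\<close> only. Finally \<open>\<eta> \<rightarrow> 0\<close>.\<close>

lemma comparison_principle:
  fixes u v :: "real^'n::finite \<Rightarrow> real" and l :: 'n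
  assumes S: "open S" "bounded S" and F: "shift_monotone K F"
    and cont: "continuous_on (closure S) u" "continuous_on (closure S) v"
    and C2: "C_class 2 S u" "C_class 2 S v"
    and c: "\<And>k x. k \<in> {1..K} \<Longrightarrow> x \<in> S \<Longrightarrow> 0 \<le> c x (a k)"
    and b: "\<And>k x. k \<in> {1..K} \<Longrightarrow> x \<in> S \<Longrightarrow> \<bar>b x (a k) $ l\<bar> \<le> B" and "B \<ge> 0" "\<nu> > 0"
    and ell: "\<And>k x \<xi>. k \<in> {1..K} \<Longrightarrow> x \<in> S \<Longrightarrow>
        \<xi> \<bullet> ((\<sigma> x (a k) ** transpose (\<sigma> x (a k))) *v \<xi>) \<ge> \<nu> * (\<xi> \<bullet> \<xi>)"
    and "\<kappa> \<ge> 0"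
    and ineq: "\<And>x. x \<in> S \<Longrightarrow> F (RK_vec K (\<lambda>k. L_op a b \<sigma> c k u x + f x (a k)))
        \<le> F (RK_vec K (\<lambda>k. L_op a b \<sigma> c k v x + f x (a k))) + \<kappa>"
    and bd: "\<And>x. x \<in> frontier S \<Longrightarrow> v x \<le> u x"
    and x: "x \<in> closure S"
  shows "v x - u x \<le> (exp ((B / (\<nu> / 2) + 1) * diameter S) - 1) * (2 * \<kappa> / \<nu>)"
proof -
  define \<alpha> where "\<alpha> = B / (\<nu> / 2) + 1"
  define d where "d = diameter S"
  have \<alpha>: "\<alpha> \<ge> 0" using assms by (simp add: \<alpha>_def)
  obtain m where m: "\<And>x. x \<in> closure S \<Longrightarrow> m \<le> x $ l \<and> x $ l \<le> m + d"
    using closure_in_coordinate_slab[OF S(2), of l] unfolding d_def by metis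
  have approx: "v x - u x \<le> (exp (\<alpha> * d) - 1) * (2 * (\<kappa> + \<eta>) / \<nu>)" if \<eta>: "\<eta> > 0" for \<eta>
  proof -
    define p where "p = 2 * (\<kappa> + \<eta>) / \<nu>"
    have p: "p \<ge> 0" using assms \<eta> by (simp add: p_def)
    define V where "V = (\<lambda>x::real^'n. p * exp (\<alpha> * d) - p * exp (\<alpha> * (x $ l - m)))"
    have V0: "V y \<ge> 0" if "y \<in> closure S" for y
    proof -
      have "\<alpha> * (y $ l - m) \<le> \<alpha> * d" using m[OF that] \<alpha> by (intro mult_left_mono) auto
      then show ?thesis using p by (simp add: V_def mult_left_mono)
    qed
    have "continuous_on (closure S) (\<lambda>x. v x - u x - V x)"
      unfolding V_def by (intro continuous_intros cont)
    moreover have "compact (closure S)" "closure S \<noteq> {}" using S x by auto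
    ultimately have "\<exists>x0\<in>closure S. \<forall>y\<in>closure S. v y - u y - V y \<le> v x0 - u x0 - V x0"
      by (intro continuous_attains_sup)
    then obtain x0 where x0: "x0 \<in> closure S"
      and mx: "\<And>y. y \<in> closure S \<Longrightarrow> v y - u y - V y \<le> v x0 - u x0 - V x0"
      by blast
    have "v x0 - u x0 - V x0 \<le> 0"
    proof (rule ccontr)
      assume "\<not> ?thesis"
      then have pos: "v x0 - u x0 > V x0" by simp
      \<comment> \<open>On the frontier \<open>v \<le> u\<close> and \<open>V \<ge> 0\<close>, so the positive maximum is not attained there.\<close>
      have "x0 \<in> S"
      proof (rule ccontr)
        assume "x0 \<notin> S"
        then have "x0 \<in> frontier S" using x0 S(1) by (simp add: frontier_def interior_open)
        then show False using bd[of x0] pos V0[OF x0] by simp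
      qed
      have "L_op a b \<sigma> c k v x0 + p * \<nu> / 2 \<le> L_op a b \<sigma> c k u x0" if k: "k \<in> {1..K}" for k
        using m[OF x0] pos V0[OF x0] \<open>x0 \<in> S\<close> closure_subset[of S] \<open>B \<ge> 0\<close> \<open>\<nu> > 0\<close> p
        by (intro L_op_less_at_max[where E="p * exp (\<alpha> * d)" and \<alpha>=\<alpha> and l=l and m=m and B=B and S=S]
            S C2 c b ell k mx[unfolded V_def] \<alpha>_def) auto
      moreover have "p * \<nu> / 2 = \<kappa> + \<eta>" using \<open>\<nu> > 0\<close> by (simp add: p_def field_simps)
      ultimately have less: "L_op a b \<sigma> c k v x0 + (\<kappa> + \<eta>) \<le> L_op a b \<sigma> c k u x0" if "k \<in> {1..K}" for k
        using that \<open>p * \<nu> / 2 = \<kappa> + \<eta>\<close> by simp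
      have "F (RK_vec K (\<lambda>k. L_op a b \<sigma> c k v x0 + f x0 (a k))) + (\<kappa> + \<eta>)
          \<le> F (RK_vec K (\<lambda>k. L_op a b \<sigma> c k u x0 + f x0 (a k)))"
        using less by (intro F[unfolded shift_monotone_def, rule_format]) (auto simp: RK_def RK_vec_def)
      with ineq[OF \<open>x0 \<in> S\<close>] \<eta> show False by simp
    qed
    then have "v x - u x \<le> V x" using mx[OF x] by simp
    also have "\<dots> \<le> p * exp (\<alpha> * d) - p * 1"
      using m[OF x] \<alpha> p unfolding V_def by (intro diff_left_mono mult_left_mono) auto
    also have "\<dots> = (exp (\<alpha> * d) - 1) * p" by (simp add: algebra_simps)
    finally show ?thesis by (simp only: p_def)
  qed
  have "((\<lambda>\<eta>. (exp (\<alpha> * d) - 1) * (2 * (\<kappa> + \<eta>) / \<nu>)) \<longlongrightarrow> (exp (\<alpha> * d) - 1) * (2 * (\<kappa> + 0) / \<nu>)) (at_right 0)"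
    using \<open>\<nu> > 0\<close> by (intro tendsto_intros) auto
  then have "v x - u x \<le> (exp (\<alpha> * d) - 1) * (2 * (\<kappa> + 0) / \<nu>)"
    by (rule tendsto_lowerbound) (use approx in \<open>auto intro!: eventually_at_rightI[of 0 1]\<close>)
  then show ?thesis by (simp add: \<alpha>_def d_def)
qed


section \<open>Derivatives up to order two\<close>

lemma C_class_2_isCont:
  assumes "open S" "C_class 2 S \<phi>" "x \<in> S"
  shows "isCont (pd j (pd i \<phi>)) x"
  using assms by (auto simp: C_class_2 continuous_on_eq_continuous_at)

text \<open>The left-hand side is symmetric in \<open>i\<close> and \<open>j\<close>, the right-hand side is a mixed derivative at a
nearby point: two applications of the mean value theorem.\<close>

lemma second_difference_eq:
  fixes \<phi> :: "real^'n::finite \<Rightarrow> real"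
  assumes C2: "C_class 2 S \<phi>" and ball: "ball x (3 * s) \<subseteq> S" and s: "s > 0"
  shows "\<exists>y\<in>ball x (3 * s). \<phi> (x + s *\<^sub>R axis i 1 + s *\<^sub>R axis j 1) - \<phi> (x + s *\<^sub>R axis i 1)
            - \<phi> (x + s *\<^sub>R axis j 1) + \<phi> x = s * s * pd j (pd i \<phi>) y"
proof -
  let ?ei = "axis i 1 :: real^'n" and ?ej = "axis j 1 :: real^'n"
  have inball: "x + r *\<^sub>R ?ej + t *\<^sub>R ?ei \<in> ball x (3 * s)"
    if "0 \<le> t" "t \<le> s" "0 \<le> r" "r \<le> s" for t r
  proof -
    have "norm (r *\<^sub>R ?ej + t *\<^sub>R ?ei) \<le> norm (r *\<^sub>R ?ej) + norm (t *\<^sub>R ?ei)" by (rule norm_triangle_ineq)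
    also have "\<dots> = t + r" using that by simp
    also have "\<dots> < 3 * s" using that s by linarith
    finally have "norm (r *\<^sub>R ?ej + t *\<^sub>R ?ei) < 3 * s" .
    moreover have "x - (x + r *\<^sub>R ?ej + t *\<^sub>R ?ei) = - (r *\<^sub>R ?ej + t *\<^sub>R ?ei)" by simp
    ultimately show ?thesis unfolding mem_ball dist_norm by (simp only: norm_minus_cancel)
  qed
  have inS: "x + r *\<^sub>R ?ej + t *\<^sub>R ?ei \<in> S"
    if "0 \<le> t" "t \<le> s" "0 \<le> r" "r \<le> s" for t r
    using inball[OF that] ball by blast
  define g where "g = (\<lambda>t. \<phi> (x + s *\<^sub>R ?ej + t *\<^sub>R ?ei) - \<phi> (x + 0 *\<^sub>R ?ej + t *\<^sub>R ?ei))"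
  have "\<exists>t>0. t < s \<and> g s - g 0 = (s - 0) *
      ((\<Sum>k\<in>UNIV. ?ei $ k * pd k \<phi> (x + s *\<^sub>R ?ej + t *\<^sub>R ?ei)) - (\<Sum>k\<in>UNIV. ?ei $ k * pd k \<phi> (x + 0 *\<^sub>R ?ej + t *\<^sub>R ?ei)))"
    unfolding g_def using C2 inS inS[of _ 0] s
    by (intro MVT2 DERIV_diff DERIV_along_line) (auto simp: C_class_2)
  then obtain t where t: "0 < t" "t < s" and
    "g s - g 0 = s * (pd i \<phi> (x + s *\<^sub>R ?ej + t *\<^sub>R ?ei) - pd i \<phi> (x + 0 *\<^sub>R ?ej + t *\<^sub>R ?ei))"
    by (auto simp: sum_axis_mult)
  then have gs: "g s - g 0 = s * (pd i \<phi> (x + t *\<^sub>R ?ei + s *\<^sub>R ?ej) - pd i \<phi> (x + t *\<^sub>R ?ei + 0 *\<^sub>R ?ej))"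
    by (simp add: add_ac)
  have "\<exists>r>0. r < s \<and> pd i \<phi> (x + t *\<^sub>R ?ei + s *\<^sub>R ?ej) - pd i \<phi> (x + t *\<^sub>R ?ei + 0 *\<^sub>R ?ej)
      = (s - 0) * (\<Sum>k\<in>UNIV. ?ej $ k * pd k (pd i \<phi>) (x + t *\<^sub>R ?ei + r *\<^sub>R ?ej))"
    using C2 inS[of t] s t
    by (intro MVT2 DERIV_along_line) (auto simp: C_class_2 add_ac)
  then obtain r where r: "0 < r" "r < s" and
    "pd i \<phi> (x + t *\<^sub>R ?ei + s *\<^sub>R ?ej) - pd i \<phi> (x + t *\<^sub>R ?ei + 0 *\<^sub>R ?ej)
      = s * pd j (pd i \<phi>) (x + t *\<^sub>R ?ei + r *\<^sub>R ?ej)"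
    by (auto simp: sum_axis_mult)
  with gs have "g s - g 0 = s * s * pd j (pd i \<phi>) (x + r *\<^sub>R ?ej + t *\<^sub>R ?ei)" by (simp add: add_ac)
  moreover have "g s - g 0 = \<phi> (x + s *\<^sub>R ?ei + s *\<^sub>R ?ej) - \<phi> (x + s *\<^sub>R ?ei) - \<phi> (x + s *\<^sub>R ?ej) + \<phi> x"
    by (simp add: g_def add_ac)
  ultimately show ?thesis using inball[of t r] t r by (intro bexI[of _ "x + r *\<^sub>R ?ej + t *\<^sub>R ?ei"]) auto
qed

text \<open>Symmetry is needed because a multi-index is a multiset: its derivative is taken in an unspecified
order, whereas bounds and limits are wanted for each iterated partial derivative.\<close>

lemma pd_commute:
  fixes \<phi> :: "real^'n::finite \<Rightarrow> real"
  assumes "open S" "C_class 2 S \<phi>" "x \<in> S"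
  shows "pd i (pd j \<phi>) x = pd j (pd i \<phi>) x"
proof (rule ccontr)
  define e where "e = dist (pd i (pd j \<phi>) x) (pd j (pd i \<phi>) x)"
  assume "pd i (pd j \<phi>) x \<noteq> pd j (pd i \<phi>) x"
  then have e: "e > 0" by (simp add: e_def)
  obtain d0 where d0: "d0 > 0" "ball x d0 \<subseteq> S" using assms open_contains_ball by blast
  have "\<exists>d>0. \<forall>y. dist y x < d \<longrightarrow> dist (pd p (pd q \<phi>) y) (pd p (pd q \<phi>) x) < e / 2" for p q
    using C_class_2_isCont[OF assms, of p q, unfolded continuous_at_eps_delta, rule_format, OF half_gt_zero[OF e]] by blast
  then obtain d1 d2 where d: "d1 > 0" "\<And>y. dist y x < d1 \<Longrightarrow> dist (pd i (pd j \<phi>) y) (pd i (pd j \<phi>) x) < e / 2"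
     "d2 > 0" "\<And>y. dist y x < d2 \<Longrightarrow> dist (pd j (pd i \<phi>) y) (pd j (pd i \<phi>) x) < e / 2"
    by meson
  define s where "s = min d0 (min d1 d2) / 3"
  have s: "s > 0" using d0 d by (simp add: s_def)
  have b: "ball x (3 * s) \<subseteq> S" using d0 by (auto simp: s_def)
  obtain y1 where y1: "y1 \<in> ball x (3 * s)" "\<phi> (x + s *\<^sub>R axis i 1 + s *\<^sub>R axis j 1) - \<phi> (x + s *\<^sub>R axis i 1)
            - \<phi> (x + s *\<^sub>R axis j 1) + \<phi> x = s * s * pd j (pd i \<phi>) y1"
    using second_difference_eq[OF assms(2) b s] by blast
  obtain y2 where y2: "y2 \<in> ball x (3 * s)" "\<phi> (x + s *\<^sub>R axis j 1 + s *\<^sub>R axis i 1) - \<phi> (x + s *\<^sub>R axis j 1)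
            - \<phi> (x + s *\<^sub>R axis i 1) + \<phi> x = s * s * pd i (pd j \<phi>) y2"
    using second_difference_eq[OF assms(2) b s] by blast
  have "s * s * pd j (pd i \<phi>) y1 = s * s * pd i (pd j \<phi>) y2"
    using y1(2) y2(2) unfolding add.assoc[of x] add.commute[of "s *\<^sub>R axis j 1" "s *\<^sub>R axis i 1"] by linarith
  then have eq: "pd j (pd i \<phi>) y1 = pd i (pd j \<phi>) y2" using s by simp
  have "dist y1 x < d2" "dist y2 x < d1"
    using y1(1) y2(1) by (auto simp: s_def dist_commute)
  then have near: "dist (pd i (pd j \<phi>) y2) (pd i (pd j \<phi>) x) < e / 2"
      "dist (pd i (pd j \<phi>) y2) (pd j (pd i \<phi>) x) < e / 2"
    using d(2)[of y2] d(4)[of y1] by (simp_all add: eq)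
  have "dist (pd i (pd j \<phi>) x) (pd j (pd i \<phi>) x) < e"
    using near by (rule dist_triangle_half_r)
  then show False by (simp add: e_def)
qed

lemma D_multi_empty [simp]: "D_multi {#} \<phi> = \<phi>"
  by (simp add: D_multi_def)

lemma D_multi_single [simp]: "D_multi {#i#} \<phi> = pd i \<phi>"
  by (simp add: D_multi_def)

lemma D_multi_pair:
  fixes \<phi> :: "real^'n::finite \<Rightarrow> real"
  assumes "open S" "C_class 2 S \<phi>" "x \<in> S"
  shows "D_multi {#i, j#} \<phi> x = pd i (pd j \<phi>) x"
proof -
  define L where "L = (SOME is. mset is = {#i, j#})"
  have "mset [i, j] = {#i, j#}" by simp
  then have L: "mset L = {#i, j#}" unfolding L_def by (rule someI)
  then have "length L = 2" by (metis size_mset size_add_mset size_empty numeral_2_eq_2)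
  then obtain p q where pq: "L = [p, q]"
    by (auto simp: numeral_2_eq_2 length_Suc_conv)
  with L have "p = i \<and> q = j \<or> p = j \<and> q = i"
    by (auto simp: add_eq_conv_ex)
  moreover have "D_multi {#i, j#} \<phi> x = pd p (pd q \<phi>) x"
    by (simp add: D_multi_def L_def[symmetric] pq)
  ultimately show ?thesis using pd_commute[OF assms, of i j] by auto
qed

lemma size_2_mset: "size \<gamma> = 2 \<Longrightarrow> \<exists>i j. \<gamma> = {#i, j#}"
proof -
  assume s: "size \<gamma> = 2"
  then obtain i N where N: "\<gamma> = add_mset i N" using size_eq_Suc_imp_eq_union[of \<gamma> 1] by auto
  with s have "size N = 1" by simp
  then obtain j where "N = {#j#}" using size_1_singleton_mset by blast
  with N show ?thesis by blast
qed

lemma size_le_2_cases [consumes 1, case_names 0 1 2]: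
  assumes "size \<gamma> \<le> 2"
  obtains "\<gamma> = {#}" | i where "\<gamma> = {#i#}" | i j where "\<gamma> = {#i, j#}"
proof -
  consider "size \<gamma> = 0" | "size \<gamma> = 1" | "size \<gamma> = 2" using assms by linarith
  then show ?thesis
  proof cases
    case 1 then show ?thesis using that(1) by simp
  next
    case 2 then show ?thesis using that(2) size_1_singleton_mset by blast
  next
    case 3 then show ?thesis using that(3) size_2_mset by blast
  qed
qed

lemma D_cl_empty [simp]: "D_cl S {#} \<phi> = \<phi>"
  by (simp add: D_cl_def fun_eq_iff)

lemma D_cl_interior: "x \<in> S \<Longrightarrow> D_cl S \<gamma> \<phi> x = D_multi \<gamma> \<phi> x"
  by (simp add: D_cl_def)

text \<open>Any continuous function on the closure that agrees with the derivative inside \<open>S\<close> is the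
extension of the derivative. All later computations with boundary values go through this fact.\<close>

lemma D_cl_eqI:
  fixes \<phi> G :: "real^'n::finite \<Rightarrow> real"
  assumes "\<gamma> \<noteq> {#}" and cont: "continuous_on (closure S) G"
    and eq: "\<And>x. x \<in> S \<Longrightarrow> D_multi \<gamma> \<phi> x = G x" and x: "x \<in> closure S"
  shows "D_cl S \<gamma> \<phi> x = G x"
proof (cases "x \<in> S")
  case False
  then have "at x within S \<noteq> bot" using x by (simp add: closure_def trivial_limit_within)
  moreover have "(G \<longlongrightarrow> G x) (at x within S)"
    using cont x closure_subset[of S] tendsto_within_subset unfolding continuous_on_def by blast
  then have "(D_multi \<gamma> \<phi> \<longlongrightarrow> G x) (at x within S)"
    by (rule tendsto_cong[THEN iffD1, rotated]) (auto simp: eventually_at_filter eq)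
  ultimately have "Lim (at x within S) (D_multi \<gamma> \<phi>) = G x" by (rule tendsto_Lim)
  then show ?thesis using assms False by (simp add: D_cl_def)
qed (simp add: D_cl_interior eq)

lemma pd_cong:
  assumes "open S" "x \<in> S" "\<And>y. y \<in> S \<Longrightarrow> \<phi> y = \<psi> y" "\<phi> differentiable (at x)"
  shows "pd i \<phi> x = pd i \<psi> x"
  using frechet_derivative_transform_within_open[OF assms(4,1,2,3)] by (simp add: pd_def)

lemma differentiable_cong:
  assumes "open S" "x \<in> S" "\<And>y. y \<in> S \<Longrightarrow> \<phi> y = \<psi> y" "\<phi> differentiable (at x)"
  shows "\<psi> differentiable (at x)"
  using assms has_derivative_transform_within_open unfolding differentiable_def by blast

lemma C_class_2_cong:
  fixes \<phi> \<psi> :: "real^'n::finite \<Rightarrow> real"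
  assumes S: "open S" and eq: "\<And>y. y \<in> S \<Longrightarrow> \<phi> y = \<psi> y" and C2: "C_class 2 S \<phi>"
  shows "C_class 2 S \<psi>" and "x \<in> S \<Longrightarrow> pd i \<phi> x = pd i \<psi> x"
    and "x \<in> S \<Longrightarrow> pd j (pd i \<phi>) x = pd j (pd i \<psi>) x"
proof -
  have d1: "\<phi> differentiable (at x)" if "x \<in> S" for x using C2 that by (simp add: C_class_2)
  have p1: "pd i \<phi> x = pd i \<psi> x" if "x \<in> S" for x i by (rule pd_cong[OF S that eq d1[OF that]])
  have d2: "pd i \<phi> differentiable (at x)" if "x \<in> S" for x i using C2 that by (simp add: C_class_2)
  have p2: "pd j (pd i \<phi>) x = pd j (pd i \<psi>) x" if "x \<in> S" for x i j
    by (rule pd_cong[OF S that p1 d2[OF that]])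
  show "x \<in> S \<Longrightarrow> pd i \<phi> x = pd i \<psi> x" "x \<in> S \<Longrightarrow> pd j (pd i \<phi>) x = pd j (pd i \<psi>) x"
    by (rule p1 p2; assumption)+
  show "C_class 2 S \<psi>" unfolding C_class_2
  proof (intro conjI allI ballI)
    show "\<psi> differentiable at x" if "x \<in> S" for x
      by (rule differentiable_cong[OF S that eq d1[OF that]])
    show "pd i \<psi> differentiable at x" if "x \<in> S" for x i
      by (rule differentiable_cong[OF S that p1 d2[OF that]])
    show "continuous_on S (pd j (pd i \<psi>))" for i j
      using C2 p2 continuous_on_cong[of S S "pd j (pd i \<phi>)" "pd j (pd i \<psi>)"] by (simp add: C_class_2)
  qed
qed

lemma pd_diff:
  assumes "\<phi> differentiable (at x)" "\<psi> differentiable (at x)"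
  shows "pd i (\<lambda>x. \<phi> x - \<psi> x) x = pd i \<phi> x - pd i \<psi> x"
proof -
  have "((\<lambda>x. \<phi> x - \<psi> x) has_derivative (\<lambda>h. frechet_derivative \<phi> (at x) h - frechet_derivative \<psi> (at x) h)) (at x)"
    using assms by (intro has_derivative_diff) (auto simp: frechet_derivative_works[symmetric])
  from frechet_derivative_at[OF this, symmetric] show ?thesis by (simp add: pd_def)
qed

lemma C_class_2_diff:
  fixes \<phi> \<psi> :: "real^'n::finite \<Rightarrow> real"
  assumes S: "open S" and C2: "C_class 2 S \<phi>" "C_class 2 S \<psi>"
  shows "C_class 2 S (\<lambda>x. \<phi> x - \<psi> x)"
    and "x \<in> S \<Longrightarrow> pd i (\<lambda>x. \<phi> x - \<psi> x) x = pd i \<phi> x - pd i \<psi> x"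
    and "x \<in> S \<Longrightarrow> pd j (pd i (\<lambda>x. \<phi> x - \<psi> x)) x = pd j (pd i \<phi>) x - pd j (pd i \<psi>) x"
proof -
  have d: "\<phi> differentiable (at x)" "\<psi> differentiable (at x)" "pd i \<phi> differentiable (at x)"
    "pd i \<psi> differentiable (at x)" if "x \<in> S" for x i
    using C2 that by (auto simp: C_class_2)
  have p1: "pd i (\<lambda>x. \<phi> x - \<psi> x) x = pd i \<phi> x - pd i \<psi> x" if "x \<in> S" for x i
    using d that by (intro pd_diff)
  have d2: "(\<lambda>x. pd i \<phi> x - pd i \<psi> x) differentiable (at x)" if "x \<in> S" for x i
    using d that by (intro differentiable_diff)
  have p2: "pd j (pd i (\<lambda>x. \<phi> x - \<psi> x)) x = pd j (pd i \<phi>) x - pd j (pd i \<psi>) x" if "x \<in> S" for x i j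
  proof -
    have "pd j (\<lambda>x. pd i \<phi> x - pd i \<psi> x) x = pd j (pd i (\<lambda>x. \<phi> x - \<psi> x)) x"
      by (rule pd_cong[OF S that p1[symmetric] d2[OF that]])
    then show ?thesis using pd_diff[OF d(3)[OF that] d(4)[OF that], of j i i] by simp
  qed
  show "x \<in> S \<Longrightarrow> pd i (\<lambda>x. \<phi> x - \<psi> x) x = pd i \<phi> x - pd i \<psi> x"
    "x \<in> S \<Longrightarrow> pd j (pd i (\<lambda>x. \<phi> x - \<psi> x)) x = pd j (pd i \<phi>) x - pd j (pd i \<psi>) x"
    by (rule p1 p2; assumption)+
  show "C_class 2 S (\<lambda>x. \<phi> x - \<psi> x)" unfolding C_class_2
  proof (intro conjI allI ballI)
    show "(\<lambda>x. \<phi> x - \<psi> x) differentiable at x" if "x \<in> S" for x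
      using d that by (intro differentiable_diff)
    show "pd i (\<lambda>x. \<phi> x - \<psi> x) differentiable at x" if "x \<in> S" for x i
      by (rule differentiable_cong[OF S that p1[symmetric] d2[OF that]])
    show "continuous_on S (pd j (pd i (\<lambda>x. \<phi> x - \<psi> x)))" for i j
      using C2 p2 continuous_on_cong[of S S "\<lambda>x. pd j (pd i \<phi>) x - pd j (pd i \<psi>) x" "pd j (pd i (\<lambda>x. \<phi> x - \<psi> x))"]
      by (simp add: C_class_2 continuous_on_diff)
  qed
qed

lemma D_multi_cong:
  fixes \<phi> \<psi> :: "real^'n::finite \<Rightarrow> real"
  assumes S: "open S" and eq: "\<And>y. y \<in> S \<Longrightarrow> \<phi> y = \<psi> y" and C2: "C_class 2 S \<phi>"
    and \<gamma>: "size \<gamma> \<le> 2" and x: "x \<in> S"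
  shows "D_multi \<gamma> \<phi> x = D_multi \<gamma> \<psi> x"
  using \<gamma>
proof (cases rule: size_le_2_cases)
  case 0 then show ?thesis by (simp add: eq[OF x])
next
  case (1 i) then show ?thesis by (simp add: C_class_2_cong(2)[OF S eq C2 x])
next
  case (2 i j)
  then show ?thesis
    by (simp only: D_multi_pair[OF S C2 x] D_multi_pair[OF S C_class_2_cong(1)[OF S eq C2] x]
        C_class_2_cong(3)[OF S eq C2 x])
qed

lemma D_multi_diff:
  fixes \<phi> \<psi> :: "real^'n::finite \<Rightarrow> real"
  assumes S: "open S" and C2: "C_class 2 S \<phi>" "C_class 2 S \<psi>"
    and \<gamma>: "size \<gamma> \<le> 2" and x: "x \<in> S"
  shows "D_multi \<gamma> (\<lambda>x. \<phi> x - \<psi> x) x = D_multi \<gamma> \<phi> x - D_multi \<gamma> \<psi> x"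
  using \<gamma>
proof (cases rule: size_le_2_cases)
  case 0 then show ?thesis by simp
next
  case (1 i) then show ?thesis by (simp add: C_class_2_diff(2)[OF S C2 x])
next
  case (2 i j)
  then show ?thesis
    by (simp only: D_multi_pair[OF S C2(1) x] D_multi_pair[OF S C2(2) x]
        D_multi_pair[OF S C_class_2_diff(1)[OF S C2] x] C_class_2_diff(3)[OF S C2 x])
qed


section \<open>Hoelder norms\<close>

lemma sup_norm_le: "(\<And>x. x \<in> X \<Longrightarrow> \<bar>\<phi> x\<bar> \<le> M) \<Longrightarrow> sup_norm X \<phi> \<le> ennreal M"
  unfolding sup_norm_def by (intro SUP_least ennreal_leI)

lemma sup_normD:
  assumes "sup_norm X \<phi> \<le> ennreal M" "0 \<le> M" "x \<in> X" shows "\<bar>\<phi> x\<bar> \<le> M"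
proof -
  have "ennreal \<bar>\<phi> x\<bar> \<le> sup_norm X \<phi>" unfolding sup_norm_def using assms(3) by (rule SUP_upper)
  then have "ennreal \<bar>\<phi> x\<bar> \<le> ennreal M" using assms(1) by order
  then show ?thesis using assms(2) by simp
qed

lemma holder_quot_le:
  assumes "\<And>x y. x \<in> X \<Longrightarrow> y \<in> X \<Longrightarrow> \<bar>\<phi> x - \<phi> y\<bar> \<le> M * norm (x - y) powr \<theta>"
  shows "holder_quot \<theta> X \<phi> \<le> ennreal M"
  unfolding holder_quot_def
proof (intro SUP_least, clarify)
  fix x y assume "x \<in> X" "y \<in> X" "x \<noteq> y"
  then show "ennreal (\<bar>\<phi> x - \<phi> y\<bar> / norm (x - y) powr \<theta>) \<le> ennreal M"
    using assms[of x y] by (intro ennreal_leI) (simp add: pos_divide_le_eq)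
qed

lemma holder_quotD:
  assumes "holder_quot \<theta> X \<phi> \<le> ennreal M" "0 \<le> M" "x \<in> X" "y \<in> X"
  shows "\<bar>\<phi> x - \<phi> y\<bar> \<le> M * norm (x - y) powr \<theta>"
proof (cases "x = y")
  case False
  have "ennreal (\<bar>\<phi> x - \<phi> y\<bar> / norm (x - y) powr \<theta>) \<le> holder_quot \<theta> X \<phi>"
    unfolding holder_quot_def using assms(3,4) False by (intro SUP_upper2[of "(x, y)"]) auto
  then have "ennreal (\<bar>\<phi> x - \<phi> y\<bar> / norm (x - y) powr \<theta>) \<le> ennreal M" using assms(1) by order
  then show ?thesis using assms(2) False by (simp add: pos_divide_le_eq)
qed simp

lemma sup_norm_le_holder_norm:
  fixes \<phi> :: "real^'n::finite \<Rightarrow> real"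
  assumes "size \<gamma> \<le> k" shows "sup_norm (closure S) (D_cl S \<gamma> \<phi>) \<le> holder_norm k \<beta> S \<phi>"
proof -
  have "sup_norm (closure S) (D_cl S \<gamma> \<phi>) \<le> semi_sup (size \<gamma>) S \<phi>"
    unfolding semi_sup_def by (rule member_le_sum) (auto simp: finite_multi_indices)
  also have "\<dots> \<le> (\<Sum>m\<le>k. semi_sup m S \<phi>)"
    using assms by (intro member_le_sum) auto
  also have "\<dots> \<le> holder_norm k \<beta> S \<phi>" by (simp add: holder_norm_def)
  finally show ?thesis .
qed

lemma holder_quot_le_holder_norm:
  fixes \<phi> :: "real^'n::finite \<Rightarrow> real"
  assumes "size \<gamma> = k" shows "holder_quot \<beta> (closure S) (D_cl S \<gamma> \<phi>) \<le> holder_norm k \<beta> S \<phi>"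
proof -
  have "holder_quot \<beta> (closure S) (D_cl S \<gamma> \<phi>) \<le> semi_holder k \<beta> S \<phi>"
    unfolding semi_holder_def using assms by (intro member_le_sum) (auto simp: finite_multi_indices)
  also have "\<dots> \<le> holder_norm k \<beta> S \<phi>" by (simp add: holder_norm_def)
  finally show ?thesis .
qed

lemma holder_norm_less_top:
  fixes \<phi> :: "real^'n::finite \<Rightarrow> real"
  assumes "\<And>\<gamma>. size \<gamma> \<le> k \<Longrightarrow> sup_norm (closure S) (D_cl S \<gamma> \<phi>) < top"
    and "\<And>\<gamma>. size \<gamma> = k \<Longrightarrow> holder_quot \<beta> (closure S) (D_cl S \<gamma> \<phi>) < top"
  shows "holder_norm k \<beta> S \<phi> < top"
  unfolding holder_norm_def semi_sup_def semi_holder_def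
  using assms by (auto simp: finite_multi_indices)

lemma holder_norm_tendsto_0:
  fixes \<phi> :: "'b \<Rightarrow> real^'n::finite \<Rightarrow> real"
  assumes "\<And>\<gamma>. size \<gamma> \<le> k \<Longrightarrow> ((\<lambda>t. sup_norm (closure S) (D_cl S \<gamma> (\<phi> t))) \<longlongrightarrow> 0) F"
    and "\<And>\<gamma>. size \<gamma> = k \<Longrightarrow> ((\<lambda>t. holder_quot \<beta> (closure S) (D_cl S \<gamma> (\<phi> t))) \<longlongrightarrow> 0) F"
  shows "((\<lambda>t. holder_norm k \<beta> S (\<phi> t)) \<longlongrightarrow> 0) F"
proof -
  have "((\<lambda>t. holder_norm k \<beta> S (\<phi> t)) \<longlongrightarrow> (\<Sum>m\<le>k. \<Sum>\<gamma>::'n multiset | size \<gamma> = m. 0)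
      + (\<Sum>\<gamma>::'n multiset | size \<gamma> = k. 0)) F"
    unfolding holder_norm_def semi_sup_def semi_holder_def
    using assms by (intro tendsto_intros) auto
  then show ?thesis by simp
qed

lemma pd_bounded_of_holder_space:
  fixes \<phi> :: "real^'n::finite \<Rightarrow> real"
  assumes "\<phi> \<in> holder_space 2 \<theta> S"
  shows "\<exists>L\<ge>0. \<forall>i. \<forall>x\<in>S. \<bar>pd i \<phi> x\<bar> \<le> L"
proof -
  define L where "L = enn2real (holder_norm 2 \<theta> S \<phi>)"
  have "holder_norm 2 \<theta> S \<phi> = ennreal L" using assms by (simp add: holder_space_def L_def)
  then have s: "sup_norm (closure S) (D_cl S {#i#} \<phi>) \<le> ennreal L" for i
    using sup_norm_le_holder_norm[of "{#i#}" 2 S \<phi> \<theta>] by simp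
  have "\<bar>pd i \<phi> x\<bar> \<le> L" if "x \<in> S" for i x
    using sup_normD[OF s, of x i] that closure_subset[of S] by (auto simp: L_def D_cl_interior)
  then show ?thesis by (intro exI[of _ L]) (auto simp: L_def)
qed

text \<open>Write \<open>A\<close> as a geometric mean of itself with weights \<open>\<beta>/\<beta>1\<close> and \<open>1 - \<beta>/\<beta>1\<close> and estimate
the two factors by the two hypotheses. Here \<open>A\<close> stands for \<open>|w(x) - w(y)|\<close> and \<open>r\<close> for \<open>|x - y|\<close>.\<close>

lemma holder_interpolation:
  fixes A M r s \<beta> \<beta>1 :: real
  assumes "0 \<le> A" "A \<le> M * r powr \<beta>1" "A \<le> s" "0 < \<beta>" "\<beta> \<le> \<beta>1" "0 \<le> M" "0 \<le> r"
  shows "A \<le> M powr (\<beta> / \<beta>1) * s powr (1 - \<beta> / \<beta>1) * r powr \<beta>"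
proof (cases "A = 0")
  case False
  define q where "q = \<beta> / \<beta>1"
  have q: "0 \<le> q" "q \<le> 1" "\<beta>1 * q = \<beta>" using assms by (auto simp: q_def)
  have "A = A powr q * A powr (1 - q)" using False assms by (simp add: powr_add[symmetric])
  also have "\<dots> \<le> (M * r powr \<beta>1) powr q * s powr (1 - q)"
    using assms q by (intro mult_mono powr_mono2) auto
  also have "(M * r powr \<beta>1) powr q = M powr q * r powr \<beta>"
    using assms q by (simp add: powr_mult powr_powr)
  finally show ?thesis by (simp add: q_def mult_ac)
qed simp

lemma holder_space_antimono:
  fixes \<phi> :: "real^'n::finite \<Rightarrow> real"
  assumes "0 < \<beta>" "\<beta> \<le> \<beta>1" and \<phi>: "\<phi> \<in> holder_space 2 \<beta>1 S"
  shows "\<phi> \<in> holder_space 2 \<beta> S"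
proof -
  define N where "N = enn2real (holder_norm 2 \<beta>1 S \<phi>)"
  have N: "holder_norm 2 \<beta>1 S \<phi> = ennreal N" "N \<ge> 0" using \<phi> by (auto simp: holder_space_def N_def)
  have s: "sup_norm (closure S) (D_cl S \<gamma> \<phi>) \<le> ennreal N" if "size \<gamma> \<le> 2" for \<gamma>
    using sup_norm_le_holder_norm[OF that, of S \<phi> \<beta>1] N by simp
  have h: "holder_quot \<beta>1 (closure S) (D_cl S \<gamma> \<phi>) \<le> ennreal N" if "size \<gamma> = 2" for \<gamma>
    using holder_quot_le_holder_norm[OF that, of \<beta>1 S \<phi>] N by simp
  have "holder_norm 2 \<beta> S \<phi> < top"
  proof (rule holder_norm_less_top)
    show "sup_norm (closure S) (D_cl S \<gamma> \<phi>) < top" if "size \<gamma> \<le> 2" for \<gamma>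
      using s[OF that] by (rule le_less_trans) simp
    show "holder_quot \<beta> (closure S) (D_cl S \<gamma> \<phi>) < top" if \<gamma>: "size \<gamma> = 2" for \<gamma>
    proof (rule le_less_trans[OF holder_quot_le])
      fix x y assume xy: "x \<in> closure S" "y \<in> closure S"
      let ?w = "D_cl S \<gamma> \<phi>"
      have "\<bar>?w x - ?w y\<bar> \<le> 2 * N"
        using sup_normD[OF s N(2) xy(1), of \<gamma>] sup_normD[OF s N(2) xy(2), of \<gamma>] \<gamma> by linarith
      then show "\<bar>?w x - ?w y\<bar> \<le> N powr (\<beta> / \<beta>1) * (2 * N) powr (1 - \<beta> / \<beta>1) * norm (x - y) powr \<beta>"
        using holder_quotD[OF h[OF \<gamma>] N(2) xy] assms N by (intro holder_interpolation) auto
    qed simp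
  qed
  then show ?thesis using \<phi> by (simp add: holder_space_def)
qed

lemma holder_space_cong:
  fixes \<phi> \<psi> :: "real^'n::finite \<Rightarrow> real"
  assumes S: "open S" and eq: "\<And>x. x \<in> closure S \<Longrightarrow> \<phi> x = \<psi> x" and \<phi>: "\<phi> \<in> holder_space 2 \<beta> S"
  shows "\<psi> \<in> holder_space 2 \<beta> S"
proof -
  have eqS: "\<phi> x = \<psi> x" if "x \<in> S" for x using eq that closure_subset by blast
  have C2: "C_class 2 S \<phi>" and cont: "\<And>\<gamma>. size \<gamma> \<le> 2 \<Longrightarrow> continuous_on (closure S) (D_cl S \<gamma> \<phi>)"
    and fin: "holder_norm 2 \<beta> S \<phi> < \<infinity>"
    using \<phi> by (auto simp: holder_space_def)
  have D: "D_cl S \<gamma> \<psi> x = D_cl S \<gamma> \<phi> x" if "size \<gamma> \<le> 2" "x \<in> closure S" for \<gamma> x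
  proof (cases "\<gamma> = {#}")
    case False
    then show ?thesis
      by (rule D_cl_eqI[OF _ cont[OF that(1)] _ that(2)])
         (simp add: D_cl_interior D_multi_cong[OF S eqS C2 that(1)])
  qed (simp add: eq that)
  have "holder_norm 2 \<beta> S \<psi> = holder_norm 2 \<beta> S \<phi>"
    unfolding holder_norm_def semi_sup_def semi_holder_def sup_norm_def holder_quot_def
    by (intro arg_cong2[of _ _ _ _ "(+)"] sum.cong SUP_cong refl) (auto simp: D)
  moreover have "C_class 2 S \<psi>" by (rule C_class_2_cong[OF S eqS C2])
  moreover have "continuous_on (closure S) (D_cl S \<gamma> \<psi>)" if "size \<gamma> \<le> 2" for \<gamma>
    using cont[OF that] D[OF that] continuous_on_cong by fastforce
  ultimately show ?thesis using fin by (simp add: holder_space_def)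
qed


section \<open>Equicontinuity up to the boundary\<close>

lemma frechet_derivative_bound:
  fixes \<phi> :: "real^'n::finite \<Rightarrow> real"
  assumes "\<phi> differentiable (at x)" "\<And>i. \<bar>pd i \<phi> x\<bar> \<le> M" "\<And>i. \<bar>h $ i\<bar> \<le> c" "c \<ge> 0"
  shows "\<bar>frechet_derivative \<phi> (at x) h\<bar> \<le> real CARD('n) * (c * M)"
proof -
  have "\<bar>frechet_derivative \<phi> (at x) h\<bar> \<le> (\<Sum>i\<in>UNIV. \<bar>h $ i * pd i \<phi> x\<bar>)"
    unfolding frechet_derivative_eq_sum_pd[OF assms(1)] by (rule sum_abs)
  also have "\<dots> \<le> real CARD('n) * (c * M)"
    using assms by (intro sum_bounded_above) (auto simp: abs_mult intro!: mult_mono)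
  finally show ?thesis .
qed

text \<open>Mean value inequality for \<open>p \<circ> \<eta>\<close>. Distances are measured in the chart, where \<open>Q\<close> is convex;
the image \<open>\<eta> ` Q\<close> is curved in general.\<close>

lemma chart_lipschitz:
  fixes p :: "real^'n::finite \<Rightarrow> real" and \<eta> :: "real^'n \<Rightarrow> real^'n"
  assumes "convex Q" and d\<eta>: "\<And>i z. z \<in> Q \<Longrightarrow> (\<lambda>y. \<eta> y $ i) differentiable (at z)"
    and L: "\<And>i j z. z \<in> Q \<Longrightarrow> \<bar>pd j (\<lambda>y. \<eta> y $ i) z\<bar> \<le> L" and sub: "\<eta> ` Q \<subseteq> S"
    and dp: "\<And>x. x \<in> S \<Longrightarrow> p differentiable (at x)"
    and N: "\<And>i x. x \<in> S \<Longrightarrow> \<bar>pd i p x\<bar> \<le> N" and pos: "L \<ge> 0" "N \<ge> 0"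
    and "x \<in> Q" "y \<in> Q"
  shows "\<bar>p (\<eta> x) - p (\<eta> y)\<bar> \<le> real CARD('n) * (real CARD('n) * L * N) * norm (x - y)"
proof -
  let ?F = "\<lambda>z i. frechet_derivative (\<lambda>y. \<eta> y $ i) (at z)"
  let ?D = "\<lambda>z h. \<Sum>i\<in>UNIV. ?F z i h *\<^sub>R axis i (1::real)"
  let ?P = "\<lambda>z. frechet_derivative p (at (\<eta> z))"
  have exp: "(\<Sum>i\<in>UNIV. v $ i *\<^sub>R axis i 1) = v" for v :: "real^'n"
    using basis_expansion[of v] by (simp add: scalar_mult_eq_scaleR)
  have D\<eta>: "(\<eta> has_derivative ?D z) (at z)" if "z \<in> Q" for z
  proof -
    have "((\<lambda>y. \<Sum>i\<in>UNIV. \<eta> y $ i *\<^sub>R axis i 1) has_derivative ?D z) (at z)"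
      using d\<eta>[OF that]
      by (intro has_derivative_sum has_derivative_scaleR_left) (simp add: frechet_derivative_works)
    then show ?thesis by (simp only: exp)
  qed
  have "norm (p (\<eta> x) - p (\<eta> y)) \<le> real CARD('n) * (real CARD('n) * L * N) * norm (x - y)"
  proof (rule differentiable_bound[OF \<open>convex Q\<close> _ _ \<open>x \<in> Q\<close> \<open>y \<in> Q\<close>, where f = "\<lambda>z. p (\<eta> z)" and f' = "\<lambda>z h. ?P z (?D z h)"])
    fix z assume z: "z \<in> Q"
    then have \<eta>z: "\<eta> z \<in> S" using sub by auto
    have "(p has_derivative ?P z) (at (\<eta> z))" using dp[OF \<eta>z] by (simp add: frechet_derivative_works)
    from diff_chain_at[OF D\<eta>[OF z] this]
    show "((\<lambda>z. p (\<eta> z)) has_derivative (\<lambda>h. ?P z (?D z h))) (at z within Q)"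
      by (simp add: o_def has_derivative_at_withinI)
    show "onorm (\<lambda>h. ?P z (?D z h)) \<le> real CARD('n) * (real CARD('n) * L * N)"
    proof (rule onorm_le)
      fix h
      have "\<bar>?F z i h\<bar> \<le> real CARD('n) * (norm h * L)" for i
        using z by (intro frechet_derivative_bound d\<eta> L component_le_norm_cart) auto
      moreover have "?D z h $ i = ?F z i h" for i
        by (simp add: axis_def if_distrib cong: if_cong)
      ultimately have "\<bar>?P z (?D z h)\<bar> \<le> real CARD('n) * ((real CARD('n) * (norm h * L)) * N)"
        using \<eta>z pos by (intro frechet_derivative_bound dp N) auto
      then show "norm (?P z (?D z h)) \<le> real CARD('n) * (real CARD('n) * L * N) * norm h"
        by (simp add: mult_ac)
    qed
  qed
  then show ?thesis by simp
qed

lemma equicontinuous_interior: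
  fixes S :: "(real^'n::finite) set"
  assumes "open S" "x0 \<in> S" "N \<ge> 0" "e > 0"
  shows "\<exists>d>0. \<forall>p. (\<forall>x\<in>S. p differentiable (at x) \<and> (\<forall>i. \<bar>pd i p x\<bar> \<le> N)) \<longrightarrow>
     (\<forall>x\<in>S \<inter> ball x0 d. \<forall>y\<in>S \<inter> ball x0 d. \<bar>p x - p y\<bar> \<le> e)"
proof -
  obtain r where r: "r > 0" "ball x0 r \<subseteq> S" using assms open_contains_ball by blast
  define C where "C = real CARD('n) * (real CARD('n) * 1 * N)"
  have C: "C \<ge> 0" using assms by (simp add: C_def)
  define d where "d = min r (e / (2 * (C + 1)))"
  have d: "d > 0" using r assms C by (simp add: d_def)
  have idd: "(\<lambda>y::real^'n. y $ i) differentiable (at z)" for i z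
    by (intro bounded_linear_imp_differentiable bounded_linear_vec_nth)
  have pdid: "\<bar>pd j (\<lambda>y::real^'n. y $ i) z\<bar> \<le> 1" for i j z
  proof -
    have "((\<lambda>y::real^'n. y $ i) has_derivative (\<lambda>y. y $ i)) (at z)"
      by (intro bounded_linear_imp_has_derivative bounded_linear_vec_nth)
    from frechet_derivative_at[OF this, symmetric] have "pd j (\<lambda>y::real^'n. y $ i) z = axis j 1 $ i"
      by (simp add: pd_def)
    then show ?thesis by (simp add: axis_def)
  qed
  have "\<bar>p x - p y\<bar> \<le> e" if p: "\<forall>x\<in>S. p differentiable (at x) \<and> (\<forall>i. \<bar>pd i p x\<bar> \<le> N)"
    and xy: "x \<in> S \<inter> ball x0 d" "y \<in> S \<inter> ball x0 d" for p x y
  proof -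
    have "\<bar>p x - p y\<bar> \<le> C * norm (x - y)"
      unfolding C_def using r xy p assms
      by (intro chart_lipschitz[where \<eta>="\<lambda>x. x" and Q="ball x0 r" and S=S] pdid idd)
         (auto simp: d_def)
    also have "\<dots> \<le> C * (2 * d)"
    proof (intro mult_left_mono C)
      have "dist x y \<le> dist x0 x + dist x0 y" by (rule dist_triangle3)
      then show "norm (x - y) \<le> 2 * d" using xy by (simp add: dist_norm)
    qed
    also have "\<dots> \<le> (C + 1) * (2 * d)" using d by simp
    also have "\<dots> \<le> (C + 1) * (2 * (e / (2 * (C + 1))))"
      using C by (intro mult_left_mono) (auto simp: d_def)
    also have "\<dots> = e" using C by (simp add: field_simps)
    finally show ?thesis .
  qed
  with d show ?thesis by blast
qed

text \<open>Let \<open>Q\<close> be the half ball around \<open>\<psi> x0\<close> in the flattened picture. It is connected, and so is \<open>\<eta> ` Q\<close>; this image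
contains a point of \<open>S\<close> and misses the frontier of \<open>S\<close>, because the chart sends the frontier to
the hyperplane \<open>y\<^sub>l = 0\<close>. Hence \<open>\<eta> ` Q\<close> lies in \<open>S\<close>, and \<open>p \<circ> \<eta>\<close> is Lipschitz on \<open>Q\<close>
with a constant that depends only on \<open>N\<close> and the chart.\<close>

lemma equicontinuous_frontier:
  fixes S :: "(real^'n::finite) set"
  assumes "open S" "boundary_class 2 \<theta> S" "x0 \<in> frontier S" "N \<ge> 0" "e > 0"
  shows "\<exists>d>0. \<forall>p. (\<forall>x\<in>S. p differentiable (at x) \<and> (\<forall>i. \<bar>pd i p x\<bar> \<le> N)) \<longrightarrow>
     (\<forall>x\<in>S \<inter> ball x0 d. \<forall>y\<in>S \<inter> ball x0 d. \<bar>p x - p y\<bar> \<le> e)"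
proof -
  obtain r D and \<psi> :: "real^'n \<Rightarrow> real^'n" and \<eta> l where "r > 0" "open D"
    and hom: "homeomorphism (ball x0 r) D \<psi> \<eta>"
    and inside: "\<psi> ` (ball x0 r \<inter> S) \<subseteq> {y. y $ l > 0}"
    and flat: "\<psi> ` (ball x0 r \<inter> frontier S) \<subseteq> {y. y $ l = 0}"
    and \<eta>: "\<And>i. (\<lambda>y. \<eta> y $ i) \<in> holder_space 2 \<theta> D"
    using assms(2,3) unfolding boundary_class_def by blast
  have "\<forall>i. \<exists>L\<ge>0. \<forall>j. \<forall>x\<in>D. \<bar>pd j (\<lambda>y. \<eta> y $ i) x\<bar> \<le> L"
    using pd_bounded_of_holder_space[OF \<eta>] by blast
  then obtain L0 where L0: "\<And>i. L0 i \<ge> 0" "\<And>i j x. x \<in> D \<Longrightarrow> \<bar>pd j (\<lambda>y. \<eta> y $ i) x\<bar> \<le> L0 i"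
    by metis
  define L where "L = (\<Sum>i\<in>UNIV. L0 i)"
  have L: "L \<ge> 0" "\<And>i j x. x \<in> D \<Longrightarrow> \<bar>pd j (\<lambda>y. \<eta> y $ i) x\<bar> \<le> L"
  proof -
    show "L \<ge> 0" using L0 by (simp add: L_def sum_nonneg)
    have "L0 i \<le> L" for i unfolding L_def using L0 by (intro member_le_sum) auto
    then show "\<And>i j x. x \<in> D \<Longrightarrow> \<bar>pd j (\<lambda>y. \<eta> y $ i) x\<bar> \<le> L" using L0 order_trans by blast
  qed
  define C where "C = real CARD('n) * (real CARD('n) * L * N)"
  have C: "C \<ge> 0" using assms L by (simp add: C_def)
  have "\<psi> x0 \<in> D" using hom \<open>r > 0\<close> by (auto simp: homeomorphism_def)
  then obtain s0 where s0: "s0 > 0" "ball (\<psi> x0) s0 \<subseteq> D"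
    using \<open>open D\<close> open_contains_ball by blast
  define s where "s = min s0 (e / (2 * (C + 1)))"
  have s: "s > 0" using s0 assms C by (simp add: s_def)
  have "continuous_on (ball x0 r) \<psi>" using hom by (simp add: homeomorphism_def)
  then have "isCont \<psi> x0" using \<open>r > 0\<close> by (simp add: continuous_on_eq_continuous_at)
  then obtain d0 where d0: "d0 > 0" "\<And>x. dist x x0 < d0 \<Longrightarrow> dist (\<psi> x) (\<psi> x0) < s"
    using s unfolding continuous_at_eps_delta by blast
  define d where "d = min d0 r"
  define Q where "Q = ball (\<psi> x0) s \<inter> {y. y $ l > 0}"
  have "convex {y::real^'n. y $ l > 0}"
    using convex_halfspace_gt[of 0 "axis l 1 :: real^'n"] by (simp add: inner_axis')
  then have Q: "convex Q" unfolding Q_def by (intro convex_Int convex_ball)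
  have QD: "Q \<subseteq> D" using s0 by (auto simp: Q_def s_def)
  have \<psi>Q: "\<psi> x \<in> Q" if "x \<in> S \<inter> ball x0 d" for x
  proof -
    have "\<psi> x \<in> \<psi> ` (ball x0 r \<inter> S)" using that by (auto simp: d_def)
    then have "\<psi> x $ l > 0" using inside by blast
    then show ?thesis using that d0(2)[of x] by (simp add: Q_def d_def dist_commute)
  qed
  have \<eta>\<psi>: "\<eta> (\<psi> x) = x" if "x \<in> S \<inter> ball x0 d" for x
    using that hom by (auto simp: homeomorphism_def d_def)
  have \<eta>Q: "\<eta> ` Q \<subseteq> S" if x: "x \<in> S \<inter> ball x0 d" for x
  proof (rule ccontr)
    assume "\<not> \<eta> ` Q \<subseteq> S"
    moreover have "connected (\<eta> ` Q)"
      using hom QD Q by (intro connected_continuous_image convex_connected)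
        (auto simp: homeomorphism_def intro: continuous_on_subset)
    moreover have "\<eta> ` Q \<inter> S \<noteq> {}" using \<psi>Q[OF x] \<eta>\<psi>[OF x] x by (metis IntI Int_iff empty_iff image_eqI)
    ultimately have "\<eta> ` Q \<inter> frontier S \<noteq> {}" by (intro connected_Int_frontier) auto
    then obtain y where y: "y \<in> Q" "\<eta> y \<in> frontier S" by auto
    then have "\<eta> y \<in> ball x0 r" "\<psi> (\<eta> y) = y" using hom QD by (auto simp: homeomorphism_def)
    then have "y $ l = 0" using flat y by fastforce
    with y show False by (simp add: Q_def)
  qed
  have "\<bar>p x - p y\<bar> \<le> e" if p: "\<forall>x\<in>S. p differentiable (at x) \<and> (\<forall>i. \<bar>pd i p x\<bar> \<le> N)"
    and xy: "x \<in> S \<inter> ball x0 d" "y \<in> S \<inter> ball x0 d" for p x y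
  proof -
    have "\<bar>p (\<eta> (\<psi> x)) - p (\<eta> (\<psi> y))\<bar> \<le> C * norm (\<psi> x - \<psi> y)"
      unfolding C_def using p assms L QD \<psi>Q[OF xy(1)] \<psi>Q[OF xy(2)] \<eta>
      by (intro chart_lipschitz[where \<eta>=\<eta> and Q=Q and S=S] Q \<eta>Q[OF xy(1)])
         (auto simp: holder_space_def C_class_2)
    also have "\<dots> \<le> C * (2 * s)"
    proof (intro mult_left_mono C)
      have "dist (\<psi> x) (\<psi> y) \<le> dist (\<psi> x0) (\<psi> x) + dist (\<psi> x0) (\<psi> y)" by (rule dist_triangle3)
      moreover have "dist (\<psi> x0) (\<psi> x) < s" "dist (\<psi> x0) (\<psi> y) < s"
        using \<psi>Q[OF xy(1)] \<psi>Q[OF xy(2)] by (auto simp: Q_def)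
      ultimately show "norm (\<psi> x - \<psi> y) \<le> 2 * s" by (simp add: dist_norm)
    qed
    also have "\<dots> \<le> (C + 1) * (2 * s)" using s by simp
    also have "\<dots> \<le> (C + 1) * (2 * (e / (2 * (C + 1))))"
      using C by (intro mult_left_mono) (auto simp: s_def)
    also have "\<dots> = e" using C by (simp add: field_simps)
    finally show ?thesis using \<eta>\<psi>[OF xy(1)] \<eta>\<psi>[OF xy(2)] by simp
  qed
  moreover have "d > 0" using d0 \<open>r > 0\<close> by (simp add: d_def)
  ultimately show ?thesis by blast
qed

text \<open>The preceding oscillation bounds hold on \<open>S\<close> near \<open>x0\<close> with a radius common to all functions. By
continuity they extend to the continuous extensions \<open>G n\<close>, first in one variable and then in the
other.\<close>

lemma equicontinuous_up_to_boundary: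
  fixes S :: "(real^'n::finite) set" and G p :: "'i \<Rightarrow> real^'n \<Rightarrow> real"
  assumes S: "open S" "boundary_class 2 \<theta> S" and x0: "x0 \<in> closure S" and N: "N \<ge> 0" and e: "e > 0"
    and cont: "\<And>n. continuous_on (closure S) (G n)" and eq: "\<And>n x. x \<in> S \<Longrightarrow> G n x = p n x"
    and dp: "\<And>n x. x \<in> S \<Longrightarrow> p n differentiable (at x)"
    and bd: "\<And>n i x. x \<in> S \<Longrightarrow> \<bar>pd i (p n) x\<bar> \<le> N"
  shows "\<exists>d>0. \<forall>n. \<forall>y\<in>closure S. norm (x0 - y) < d \<longrightarrow> \<bar>G n x0 - G n y\<bar> < e"
proof -
  have "x0 \<in> S \<or> x0 \<in> frontier S" using x0 S by (auto simp: frontier_def interior_open)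
  then have "\<exists>d>0. \<forall>p. (\<forall>x\<in>S. p differentiable (at x) \<and> (\<forall>i. \<bar>pd i p x\<bar> \<le> N)) \<longrightarrow>
     (\<forall>x\<in>S \<inter> ball x0 d. \<forall>y\<in>S \<inter> ball x0 d. \<bar>p x - p y\<bar> \<le> e / 2)"
    using equicontinuous_interior[OF S(1) _ N, of x0 "e / 2"] equicontinuous_frontier[OF S _ N, of x0 "e / 2"] e
    by (meson half_gt_zero)
  then obtain d where d: "d > 0" and osc: "\<And>n x y. x \<in> S \<inter> ball x0 d \<Longrightarrow> y \<in> S \<inter> ball x0 d \<Longrightarrow> \<bar>p n x - p n y\<bar> \<le> e / 2"
    using dp bd by (metis (no_types, lifting))
  let ?B = "S \<inter> ball x0 d"
  have cl: "closure S \<inter> ball x0 d \<subseteq> closure ?B"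
    using open_Int_closure_subset[OF open_ball, of x0 d S] by (simp add: Int_commute)
  have B: "closure ?B \<subseteq> closure S" by (intro closure_mono) auto
  have 1: "\<bar>G n x - G n y\<bar> \<le> e / 2" if x: "x \<in> ?B" and y: "y \<in> closure ?B" for n x y
  proof -
    have "norm (G n x - G n y) \<le> e / 2"
    proof (rule continuous_on_closure_norm_le[of ?B "\<lambda>y. G n x - G n y", OF _ _ y])
      show "continuous_on (closure ?B) (\<lambda>y. G n x - G n y)"
        using continuous_on_subset[OF cont B] by (intro continuous_intros)
      show "\<forall>y\<in>?B. norm (G n x - G n y) \<le> e / 2" using osc[OF x] x eq by auto
    qed
    then show ?thesis by simp
  qed
  have 2: "\<bar>G n x - G n y\<bar> \<le> e / 2" if x: "x \<in> closure ?B" and y: "y \<in> closure ?B" for n x y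
  proof -
    have "norm (G n x - G n y) \<le> e / 2"
    proof (rule continuous_on_closure_norm_le[of ?B "\<lambda>x. G n x - G n y", OF _ _ x])
      show "continuous_on (closure ?B) (\<lambda>x. G n x - G n y)"
        using continuous_on_subset[OF cont B] by (intro continuous_intros)
      show "\<forall>x\<in>?B. norm (G n x - G n y) \<le> e / 2" using 1[OF _ y] by auto
    qed
    then show ?thesis by simp
  qed
  have "\<bar>G n x0 - G n y\<bar> < e" if "y \<in> closure S" "norm (x0 - y) < d" for n y
    using 2[of x0 y n] cl x0 d that e by (force simp: dist_norm)
  with d show ?thesis by blast
qed


section \<open>Compactness in Hoelder spaces\<close>

text \<open>Restricted to the line through \<open>x\<close> in the direction of the \<open>i\<close>-th axis, this is the theorem
on exchanging limit and derivative.\<close>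

lemma pd_of_uniform_limit:
  fixes \<phi> :: "nat \<Rightarrow> real^'n::finite \<Rightarrow> real"
  assumes "open S" "x \<in> S"
    and d\<phi>: "\<And>n x. x \<in> S \<Longrightarrow> \<phi> n differentiable (at x)" and d\<psi>: "\<psi> differentiable (at x)"
    and lim: "\<And>y. y \<in> S \<Longrightarrow> (\<lambda>n. \<phi> n y) \<longlonglongrightarrow> \<psi> y"
    and unif: "uniform_limit S (\<lambda>n. pd i (\<phi> n)) G sequentially"
  shows "pd i \<psi> x = G x"
proof -
  obtain r where r: "r > 0" "ball x r \<subseteq> S" using assms(1,2) open_contains_ball by blast
  let ?l = "\<lambda>t::real. x + t *\<^sub>R axis i 1"
  have lS: "?l t \<in> S" if "t \<in> ball 0 r" for t :: real
  proof -
    have "?l t \<in> ball x r" using that by (simp add: dist_norm)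
    then show ?thesis using r by blast
  qed
  have "\<exists>h. \<forall>t\<in>ball 0 r. (\<lambda>n. \<phi> n (?l t)) \<longlonglongrightarrow> h t \<and> (h has_derivative (*) (G (?l t))) (at t within ball 0 r)"
  proof (rule has_derivative_sequence[where ?x0.0 = 0 and l = "\<psi> x" and f' = "\<lambda>n t. (*) (pd i (\<phi> n) (?l t))"])
    show "((\<lambda>t. \<phi> n (?l t)) has_derivative (*) (pd i (\<phi> n) (?l t))) (at t within ball 0 r)"
      if "t \<in> ball 0 r" for n and t :: real
      using DERIV_along_line[OF d\<phi>[OF lS[OF that]], of n]
      by (simp add: sum_axis_mult has_field_derivative_def has_derivative_at_withinI)
    show "\<forall>\<^sub>F n in sequentially. \<forall>t\<in>ball 0 r. \<forall>h. norm (pd i (\<phi> n) (?l t) * h - G (?l t) * h) \<le> e * norm h"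
      if "e > 0" for e
      using uniform_limitD[OF unif that]
    proof (rule eventually_mono, intro ballI allI)
      fix n and t h :: real assume "\<forall>x\<in>S. dist (pd i (\<phi> n) x) (G x) < e" "t \<in> ball 0 r"
      then have "\<bar>pd i (\<phi> n) (?l t) - G (?l t)\<bar> \<le> e" using lS by (auto simp: dist_real_def less_imp_le)
      then show "norm (pd i (\<phi> n) (?l t) * h - G (?l t) * h) \<le> e * norm h"
        by (simp add: left_diff_distrib[symmetric] abs_mult mult_right_mono)
    qed
  qed (use r lim[OF assms(2)] in auto)
  then obtain h where h: "\<And>t::real. t \<in> ball 0 r \<Longrightarrow> (\<lambda>n. \<phi> n (?l t)) \<longlonglongrightarrow> h t"
    "\<And>t. t \<in> ball 0 r \<Longrightarrow> (h has_derivative (*) (G (?l t))) (at t within ball 0 r)" by blast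
  have eq: "h t = \<psi> (?l t)" if "t \<in> ball 0 r" for t :: real
    using LIMSEQ_unique[OF h(1)[OF that] lim[OF lS[OF that]]] .
  have "0 \<in> ball (0::real) r" using r by simp
  then have "(h has_derivative (*) (G (?l 0))) (at 0)"
    using h(2)[of 0] at_within_open[of "0::real" "ball 0 r"] by (metis open_ball)
  then have "((\<lambda>t. \<psi> (?l t)) has_derivative (*) (G (?l 0))) (at 0)"
    by (rule has_derivative_transform_within_open[OF _ open_ball \<open>0 \<in> ball 0 r\<close>]) (rule eq)
  then have "((\<lambda>t. \<psi> (?l t)) has_real_derivative G (?l 0)) (at 0)"
    by (simp add: has_field_derivative_def)
  moreover have "\<psi> differentiable (at (?l 0))" using d\<psi> by simp
  from DERIV_along_line[OF this] have "((\<lambda>t. \<psi> (?l t)) has_real_derivative pd i \<psi> (?l 0)) (at 0)"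
    by (simp only: sum_axis_mult)
  ultimately have "pd i \<psi> (?l 0) = G (?l 0)" by (rule DERIV_unique[rotated])
  then show ?thesis by simp
qed

text \<open>Each subsequence has, by Arzela--Ascoli, a further subsequence with a uniform limit, which must be
\<open>pd i \<psi>\<close> inside \<open>S\<close> and is therefore determined on the closure. A limit shared by all
subsequences is the limit of the whole sequence.\<close>

lemma derivatives_converge_uniformly:
  fixes \<phi> G :: "nat \<Rightarrow> real^'n::finite \<Rightarrow> real"
  assumes S: "open S" "bounded S"
    and d\<phi>: "\<And>n x. x \<in> S \<Longrightarrow> \<phi> n differentiable (at x)" and d\<psi>: "\<And>x. x \<in> S \<Longrightarrow> \<psi> differentiable (at x)"
    and lim: "\<And>x. x \<in> S \<Longrightarrow> (\<lambda>n. \<phi> n x) \<longlonglongrightarrow> \<psi> x"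
    and eq: "\<And>n x. x \<in> S \<Longrightarrow> G n x = pd i (\<phi> n) x"
    and bd: "\<And>n x. x \<in> closure S \<Longrightarrow> \<bar>G n x\<bar> \<le> M"
    and equi: "\<And>x e. x \<in> closure S \<Longrightarrow> e > 0 \<Longrightarrow>
       \<exists>d>0. \<forall>n. \<forall>y\<in>closure S. norm (x - y) < d \<longrightarrow> \<bar>G n x - G n y\<bar> < e"
  shows "\<exists>g. continuous_on (closure S) g \<and> (\<forall>x\<in>S. g x = pd i \<psi> x) \<and> uniform_limit (closure S) G g sequentially"
proof -
  have sub: "\<exists>g k. continuous_on (closure S) g \<and> (\<forall>x\<in>S. g x = pd i \<psi> x) \<and>
      uniform_limit (closure S) (\<lambda>n. G (r (k n))) g sequentially"
    if r: "strict_mono r" for r :: "nat \<Rightarrow> nat"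
  proof -
    have "compact (closure S)" using S by simp
    moreover have "\<exists>d. 0 < d \<and> (\<forall>n y. y \<in> closure S \<and> norm (x - y) < d \<longrightarrow> norm (G (r n) x - G (r n) y) < e)"
      if "x \<in> closure S" "0 < e" for x e
      using equi[OF that] by force
    ultimately obtain g k where g: "continuous_on (closure S) g" and k: "strict_mono (k :: nat \<Rightarrow> nat)"
      and conv: "\<And>e. 0 < e \<Longrightarrow> \<exists>N. \<forall>n x. n \<ge> N \<and> x \<in> closure S \<longrightarrow> norm (G (r (k n)) x - g x) < e"
      using Arzela_Ascoli[of "closure S" "\<lambda>n. G (r n)" M] bd by (metis real_norm_def)
    have unif: "uniform_limit (closure S) (\<lambda>n. G (r (k n))) g sequentially"
    proof (rule uniform_limitI)
      fix e :: real assume "e > 0"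
      from conv[OF this] show "\<forall>\<^sub>F n in sequentially. \<forall>x\<in>closure S. dist (G (r (k n)) x) (g x) < e"
        by (auto simp: eventually_sequentially dist_norm)
    qed
    have "pd i \<psi> x = g x" if x: "x \<in> S" for x
    proof (rule pd_of_uniform_limit[OF S(1) x, of "\<lambda>n. \<phi> (r (k n))"])
      show "(\<lambda>n. \<phi> (r (k n)) y) \<longlonglongrightarrow> \<psi> y" if "y \<in> S" for y
        using LIMSEQ_subseq_LIMSEQ[OF lim[OF that] strict_mono_compose[OF r k]] by (simp add: o_def)
      have "uniform_limit S (\<lambda>n. G (r (k n))) g sequentially"
        using unif closure_subset by (rule uniform_limit_on_subset)
      then show "uniform_limit S (\<lambda>n. pd i (\<phi> (r (k n)))) g sequentially"
        by (rule uniform_limit_cong'[THEN iffD1, rotated 2]) (auto simp: eq)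
    qed (use d\<phi> d\<psi> x in auto)
    with g unif show ?thesis by metis
  qed
  obtain g where g: "continuous_on (closure S) g" "\<And>x. x \<in> S \<Longrightarrow> g x = pd i \<psi> x"
    using sub[OF strict_mono_id] by blast
  have "uniform_limit (closure S) G g sequentially"
  proof (rule uniform_limitI, rule ccontr)
    fix e :: real assume e: "e > 0"
      and "\<not> (\<forall>\<^sub>F n in sequentially. \<forall>x\<in>closure S. dist (G n x) (g x) < e)"
    then have "infinite {n. \<not> (\<forall>x\<in>closure S. dist (G n x) (g x) < e)}"
      by (simp add: cofinite_eq_sequentially[symmetric] eventually_cofinite)
    then obtain r :: "nat \<Rightarrow> nat" where r: "strict_mono r"
      and bad: "\<And>n. \<not> (\<forall>x\<in>closure S. dist (G (r n) x) (g x) < e)"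
      using infinite_enumerate by blast
    obtain g' k where g': "continuous_on (closure S) g'" "\<And>x. x \<in> S \<Longrightarrow> g' x = pd i \<psi> x"
      and unif: "uniform_limit (closure S) (\<lambda>n. G (r (k n))) g' sequentially"
      using sub[OF r] by blast
    have "g' x - g x = 0" if "x \<in> closure S" for x
      by (rule continuous_constant_on_closure[of S "\<lambda>x. g' x - g x"])
         (use g g' that in \<open>auto intro: continuous_on_diff\<close>)
    then have "\<forall>\<^sub>F n in sequentially. \<forall>x\<in>closure S. dist (G (r (k n)) x) (g x) < e"
      using uniform_limitD[OF unif e] by simp
    then show False using bad by (auto simp: eventually_sequentially)
  qed
  with g show ?thesis by blast
qed

lemma tendsto_0_ennrealI:
  assumes "\<And>e::real. e > 0 \<Longrightarrow> \<forall>\<^sub>F t in F. f t \<le> ennreal e"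
  shows "(f \<longlongrightarrow> 0) F"
proof (rule order_tendstoI)
  fix a :: ennreal assume "0 < a"
  then obtain z where z: "0 < z" "z < a" using dense by blast
  then obtain e where e: "z = ennreal e" "e > 0" by (cases z) (auto simp: ennreal_zero_less_top)
  show "\<forall>\<^sub>F t in F. f t < a"
    using assms[OF e(2)] by eventually_elim (use z e in order)
qed simp

text \<open>A bounded sequence in \<open>C\<^bsup>2,\<beta>1\<^esup>\<close> that converges uniformly converges in \<open>C\<^bsup>2,\<beta>\<^esup>\<close> for
smaller \<open>\<beta>\<close>. The derivatives are treated in increasing order, since convergence of the
first derivatives is what identifies the limit of the second ones.\<close>

lemma holder_compactness:
  fixes v :: "nat \<Rightarrow> real^'n::finite \<Rightarrow> real"
  assumes S: "open S" "bounded S" "boundary_class 2 \<theta> S" and \<beta>: "0 < \<beta>" "\<beta> < \<beta>1"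
    and u: "C_class 2 S u" "continuous_on (closure S) u"
    and v: "\<And>n. v n \<in> holder_space 2 \<beta>1 S"
    and N: "\<And>n. holder_norm 2 \<beta>1 S (v n) \<le> ennreal N" "N \<ge> 0"
    and lim: "uniform_limit (closure S) v u sequentially"
  shows "u \<in> holder_space 2 \<beta> S" "(\<lambda>n. holder_norm 2 \<beta> S (\<lambda>x. v n x - u x)) \<longlonglongrightarrow> 0"
proof -
  have vC2: "C_class 2 S (v n)" and vcont: "size \<gamma> \<le> 2 \<Longrightarrow> continuous_on (closure S) (D_cl S \<gamma> (v n))" for n \<gamma>
    using v[of n] by (auto simp: holder_space_def)
  have vd: "v n differentiable (at x)" "pd i (v n) differentiable (at x)"
      "u differentiable (at x)" "pd i u differentiable (at x)" if "x \<in> S" for n x i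
    using vC2[of n] u that by (auto simp: C_class_2)
  have vsup: "\<bar>D_cl S \<gamma> (v n) x\<bar> \<le> N" if "size \<gamma> \<le> 2" "x \<in> closure S" for \<gamma> n x
    using sup_normD[OF order_trans[OF sup_norm_le_holder_norm[OF that(1)] N(1)] N(2) that(2)] .
  have vhol: "\<bar>D_cl S \<gamma> (v n) x - D_cl S \<gamma> (v n) y\<bar> \<le> N * norm (x - y) powr \<beta>1"
    if "size \<gamma> = 2" "x \<in> closure S" "y \<in> closure S" for \<gamma> n x y
    using holder_quotD[OF order_trans[OF holder_quot_le_holder_norm[OF that(1)] N(1)] N(2) that(2,3)] .
  have \<beta>1: "\<beta>1 > 0" using \<beta> by simp
  have inS: "x \<in> closure S" if "x \<in> S" for x using that closure_subset by blast
  have int2: "D_cl S {#i, j#} (v n) x = pd i (pd j (v n)) x" if "x \<in> S" for i j n x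
    using that by (simp add: D_cl_interior D_multi_pair[OF S(1) vC2])
  have bound2: "\<bar>pd j (pd i (v n)) x\<bar> \<le> N" if "x \<in> S" for i j n x
    using vsup[of "{#j, i#}" x n] int2[OF that] inS[OF that] by simp
  have conv1: "\<exists>g. continuous_on (closure S) g \<and> (\<forall>x\<in>S. g x = pd i u x) \<and>
      uniform_limit (closure S) (\<lambda>n. D_cl S {#i#} (v n)) g sequentially" for i
  proof (rule derivatives_converge_uniformly[OF S(1,2), of v])
    show "(\<lambda>n. v n x) \<longlonglongrightarrow> u x" if "x \<in> S" for x
      using tendsto_uniform_limitI[OF lim inS[OF that]] .
    show "\<exists>d>0. \<forall>n. \<forall>y\<in>closure S. norm (x - y) < d \<longrightarrow> \<bar>D_cl S {#i#} (v n) x - D_cl S {#i#} (v n) y\<bar> < e"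
      if "x \<in> closure S" "e > 0" for x e
      by (rule equicontinuous_up_to_boundary[OF S(1,3) that(1) N(2) that(2), of _ "\<lambda>n. pd i (v n)"])
         (use vcont vd bound2 in \<open>auto simp: D_cl_interior\<close>)
  qed (use vd vsup[of "{#i#}"] in \<open>auto simp: D_cl_interior\<close>)
  have conv2: "\<exists>g. continuous_on (closure S) g \<and> (\<forall>x\<in>S. g x = pd i (pd j u) x) \<and>
      uniform_limit (closure S) (\<lambda>n. D_cl S {#i, j#} (v n)) g sequentially" for i j
  proof (rule derivatives_converge_uniformly[OF S(1,2), of "\<lambda>n. pd j (v n)"])
    show "(\<lambda>n. pd j (v n) x) \<longlonglongrightarrow> pd j u x" if x: "x \<in> S" for x
    proof -
      obtain g where g: "g x = pd j u x" "uniform_limit (closure S) (\<lambda>n. D_cl S {#j#} (v n)) g sequentially"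
        using conv1[of j] x by blast
      from tendsto_uniform_limitI[OF g(2) inS[OF x]] show ?thesis using x by (simp add: g D_cl_interior)
    qed
    show "\<exists>d>0. \<forall>n. \<forall>y\<in>closure S. norm (x - y) < d \<longrightarrow> \<bar>D_cl S {#i, j#} (v n) x - D_cl S {#i, j#} (v n) y\<bar> < e"
      if x: "x \<in> closure S" and e: "e > 0" for x e
    proof -
      \<comment> \<open>The radius at which the Hoelder bound \<open>N d\<^sup>\<beta>\<^sup>1\<close> falls below \<open>e\<close>.\<close>
      define d where "d = (e / (N + 1)) powr (1 / \<beta>1)"
      have d: "d > 0" using e N by (simp add: d_def)
      have "\<bar>D_cl S {#i, j#} (v n) x - D_cl S {#i, j#} (v n) y\<bar> < e"
        if y: "y \<in> closure S" "norm (x - y) < d" for n y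
      proof -
        have "norm (x - y) powr \<beta>1 \<le> d powr \<beta>1" using y \<beta>1 by (intro powr_mono2) auto
        also have "\<dots> = e / (N + 1)" using e N \<beta>1 by (simp add: d_def powr_powr)
        finally have le: "norm (x - y) powr \<beta>1 \<le> e / (N + 1)" .
        have "\<bar>D_cl S {#i, j#} (v n) x - D_cl S {#i, j#} (v n) y\<bar> \<le> N * norm (x - y) powr \<beta>1"
          using x y by (intro vhol) auto
        also have "\<dots> \<le> N * (e / (N + 1))" using le N by (intro mult_left_mono) auto
        also have "\<dots> < e" using e N by (simp add: field_simps)
        finally show ?thesis .
      qed
      with d show ?thesis by blast
    qed
  qed (use vd vsup[of "{#i, j#}"] int2 in auto)
  have main: "continuous_on (closure S) (D_cl S \<gamma> u) \<and>
      uniform_limit (closure S) (\<lambda>n. D_cl S \<gamma> (v n)) (D_cl S \<gamma> u) sequentially" if \<gamma>: "size \<gamma> \<le> 2" for \<gamma>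
  proof (cases "\<gamma> = {#}")
    case True
    then show ?thesis using u lim by simp
  next
    case False
    have "\<exists>g. continuous_on (closure S) g \<and> (\<forall>x\<in>S. g x = D_multi \<gamma> u x) \<and>
      uniform_limit (closure S) (\<lambda>n. D_cl S \<gamma> (v n)) g sequentially"
      using \<gamma>
    proof (cases rule: size_le_2_cases)
      case (1 i) then show ?thesis using conv1[of i] by simp
    next
      case (2 i j) then show ?thesis using conv2[of i j] D_multi_pair[OF S(1) u(1)] by simp
    qed (use False in simp)
    then obtain g where g: "continuous_on (closure S) g" "\<And>x. x \<in> S \<Longrightarrow> D_multi \<gamma> u x = g x"
      "uniform_limit (closure S) (\<lambda>n. D_cl S \<gamma> (v n)) g sequentially" by metis
    have eq: "D_cl S \<gamma> u x = g x" if "x \<in> closure S" for x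
      by (rule D_cl_eqI[OF False g(1,2) that])
    have "continuous_on (closure S) (D_cl S \<gamma> u)"
      using g(1) eq continuous_on_cong by fastforce
    moreover have "uniform_limit (closure S) (\<lambda>n. D_cl S \<gamma> (v n)) (D_cl S \<gamma> u) sequentially"
      using g(3) by (rule uniform_limit_cong'[THEN iffD1, rotated 2]) (auto simp: eq)
    ultimately show ?thesis by blast
  qed
  have ulim: "(\<lambda>n. D_cl S \<gamma> (v n) x) \<longlonglongrightarrow> D_cl S \<gamma> u x" if "size \<gamma> \<le> 2" "x \<in> closure S" for \<gamma> x
    using tendsto_uniform_limitI[OF conjunct2[OF main[OF that(1)]] that(2)] .
  have usup: "\<bar>D_cl S \<gamma> u x\<bar> \<le> N" if "size \<gamma> \<le> 2" "x \<in> closure S" for \<gamma> x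
    using tendsto_rabs[OF ulim[OF that]] by (rule LIMSEQ_le_const2) (auto simp: vsup that)
  have uhol: "\<bar>D_cl S \<gamma> u x - D_cl S \<gamma> u y\<bar> \<le> N * norm (x - y) powr \<beta>1"
    if "size \<gamma> = 2" "x \<in> closure S" "y \<in> closure S" for \<gamma> x y
    using tendsto_rabs[OF tendsto_diff[OF ulim ulim]] by (rule LIMSEQ_le_const2) (auto simp: vhol that)
  have "holder_norm 2 \<beta>1 S u < top"
  proof (rule holder_norm_less_top)
    show "sup_norm (closure S) (D_cl S \<gamma> u) < top" if "size \<gamma> \<le> 2" for \<gamma>
      by (rule le_less_trans[OF sup_norm_le]) (use usup[OF that] in auto)
    show "holder_quot \<beta>1 (closure S) (D_cl S \<gamma> u) < top" if "size \<gamma> = 2" for \<gamma>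
      by (rule le_less_trans[OF holder_quot_le]) (use uhol[OF that] in auto)
  qed
  then have "u \<in> holder_space 2 \<beta>1 S" using u main by (simp add: holder_space_def)
  then show "u \<in> holder_space 2 \<beta> S" using \<beta> by (intro holder_space_antimono[of \<beta> \<beta>1]) auto
  have diff: "D_cl S \<gamma> (\<lambda>x. v n x - u x) x = D_cl S \<gamma> (v n) x - D_cl S \<gamma> u x"
    if \<gamma>: "size \<gamma> \<le> 2" and x: "x \<in> closure S" for \<gamma> n x
  proof (cases "\<gamma> = {#}")
    case False
    then show ?thesis
      by (rule D_cl_eqI[where G = "\<lambda>x. D_cl S \<gamma> (v n) x - D_cl S \<gamma> u x", OF _ continuous_on_diff[OF vcont[OF \<gamma>] conjunct1[OF main[OF \<gamma>]]] _ x])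
         (simp add: D_cl_interior D_multi_diff[OF S(1) vC2 u(1) \<gamma>])
  qed simp
  have small: "\<forall>\<^sub>F n in sequentially. \<forall>x\<in>closure S. \<bar>D_cl S \<gamma> (\<lambda>x. v n x - u x) x\<bar> \<le> e"
    if "size \<gamma> \<le> 2" "e > 0" for \<gamma> and e :: real
    using uniform_limitD[OF conjunct2[OF main[OF that(1)]] that(2)]
    by eventually_elim (auto simp: diff[OF that(1)] dist_real_def intro: less_imp_le)
  show "(\<lambda>n. holder_norm 2 \<beta> S (\<lambda>x. v n x - u x)) \<longlonglongrightarrow> 0"
  proof (rule holder_norm_tendsto_0; rule tendsto_0_ennrealI)
    fix \<gamma> :: "'n multiset" and e :: real assume \<gamma>: "size \<gamma> \<le> 2" and e: "e > 0"
    show "\<forall>\<^sub>F n in sequentially. sup_norm (closure S) (D_cl S \<gamma> (\<lambda>x. v n x - u x)) \<le> ennreal e"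
      using small[OF \<gamma> e] by eventually_elim (auto intro: sup_norm_le)
  next
    fix \<gamma> :: "'n multiset" and e :: real assume \<gamma>: "size \<gamma> = 2" and e: "e > 0"
    then have \<gamma>2: "size \<gamma> \<le> 2" by simp
    define q where "q = 1 - \<beta> / \<beta>1"
    have q: "q > 0" using \<beta> by (simp add: q_def)
    define C where "C = (2 * N) powr (\<beta> / \<beta>1)"
    have C: "C \<ge> 0" by (simp add: C_def)
    \<comment> \<open>The uniform smallness that makes the interpolated seminorm at most \<open>e\<close>.\<close>
    define s where "s = (e / (C + 1)) powr (1 / q) / 2"
    have s: "s > 0" using e C by (simp add: s_def)
    have s_powr: "(2 * s) powr q = e / (C + 1)" using e C q by (simp add: s_def powr_powr)
    have Cs: "C * (2 * s) powr q \<le> e" unfolding s_powr using e C by (simp add: field_simps)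
    show "\<forall>\<^sub>F n in sequentially. holder_quot \<beta> (closure S) (D_cl S \<gamma> (\<lambda>x. v n x - u x)) \<le> ennreal e"
      using small[OF \<gamma>2 s]
    proof eventually_elim
      fix n assume sm: "\<forall>x\<in>closure S. \<bar>D_cl S \<gamma> (\<lambda>x. v n x - u x) x\<bar> \<le> s"
      let ?w = "D_cl S \<gamma> (\<lambda>x. v n x - u x)"
      show "holder_quot \<beta> (closure S) ?w \<le> ennreal e"
      proof (rule holder_quot_le)
        fix x y assume xy: "x \<in> closure S" "y \<in> closure S"
        have "\<bar>?w x - ?w y\<bar> \<le> 2 * N * norm (x - y) powr \<beta>1"
          using vhol[OF \<gamma> xy, of n] uhol[OF \<gamma> xy] unfolding diff[OF \<gamma>2 xy(1)] diff[OF \<gamma>2 xy(2)] by linarith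
        moreover have "\<bar>?w x\<bar> \<le> s" "\<bar>?w y\<bar> \<le> s" using sm xy by auto
        then have "\<bar>?w x - ?w y\<bar> \<le> 2 * s" by linarith
        ultimately have "\<bar>?w x - ?w y\<bar> \<le> C * (2 * s) powr q * norm (x - y) powr \<beta>"
          unfolding C_def q_def using \<beta> N by (intro holder_interpolation) auto
        also have "\<dots> \<le> e * norm (x - y) powr \<beta>" using Cs by (intro mult_right_mono) auto
        finally show "\<bar>?w x - ?w y\<bar> \<le> e * norm (x - y) powr \<beta>" .
      qed
    qed
  qed
qed


section \<open>Convergence of the penalised solutions\<close>

text \<open>The control set only labels the coefficients. Relabelling the controls by their numbers makes the
regularity constant, which is stated for numerical labels, available for any control set.\<close>

lemma H1_relabel:
  assumes "H1 K a A S \<nu> \<Lambda> \<theta> g b \<sigma> c f"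
  shows "H1 K (\<lambda>k. k) {1..K} S \<nu> \<Lambda> \<theta> g (\<lambda>x k. b x (a k)) (\<lambda>x k. \<sigma> x (a k))
           (\<lambda>x k. c x (a k)) (\<lambda>x k. f x (a k))"
  using assms by (simp add: H1_def bij_betw_def)

lemma is_solution_relabel:
  "is_solution F K (\<lambda>k. k) S g (\<lambda>x k. b x (a k)) (\<lambda>x k. \<sigma> x (a k)) (\<lambda>x k. c x (a k)) (\<lambda>x k. f x (a k)) v
     \<longleftrightarrow> is_solution F K a S g b \<sigma> c f v"
  by (simp add: is_solution_def L_op_def)

lemma sigma_bound_relabel: "sigma_bound K (\<lambda>k. k) S (\<lambda>x k. \<sigma> x (a k)) = sigma_bound K a S \<sigma>"
  by (simp add: sigma_bound_def)

lemma drift_bounded: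
  fixes b :: "real^'n::finite \<Rightarrow> 'a \<Rightarrow> real^'n"
  assumes "H1 K a A S \<nu> \<Lambda> \<theta> g b \<sigma> c f" "k \<in> {1..K}" "x \<in> closure S"
  shows "\<bar>b x (a k) $ l\<bar> \<le>
    Max ((\<lambda>k. \<Sum>i\<in>UNIV. enn2real (sup_norm (closure S) (\<lambda>y. b y (a k) $ i))) ` {1..K})"
proof -
  let ?s = "\<lambda>i. sup_norm (closure S) (\<lambda>y. b y (a k) $ i)"
  let ?h = "\<lambda>i. holder_norm 0 1 UNIV (\<lambda>x. b x (a k) $ i)"
  let ?rest = "(\<Sum>i\<in>UNIV. \<Sum>j\<in>UNIV. holder_norm 0 1 UNIV (\<lambda>x. \<sigma> x (a k) $ i $ j))"
  have "?rest + (\<Sum>i\<in>UNIV. ?h i) + holder_norm 0 \<theta> S (\<lambda>x. c x (a k)) + holder_norm 0 \<theta> S (\<lambda>x. f x (a k)) \<le> ennreal \<Lambda>"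
    using assms(1,2) unfolding H1_def by blast
  moreover have "(\<Sum>i\<in>UNIV. ?h i) \<le> ?rest + (\<Sum>i\<in>UNIV. ?h i) + holder_norm 0 \<theta> S (\<lambda>x. c x (a k)) + holder_norm 0 \<theta> S (\<lambda>x. f x (a k))"
    by (simp add: add_increasing add_increasing2)
  ultimately have "(\<Sum>i\<in>UNIV. ?h i) \<le> ennreal \<Lambda>" by order
  moreover have "?h l \<le> (\<Sum>i\<in>UNIV. ?h i)" by (intro member_le_sum) auto
  moreover have "?s l \<le> sup_norm (closure UNIV) (D_cl UNIV {#} (\<lambda>y. b y (a k) $ l))"
    unfolding sup_norm_def by (intro SUP_subset_mono) auto
  moreover have "\<dots> \<le> ?h l" by (rule sup_norm_le_holder_norm) simp
  ultimately have "?s l \<le> ennreal \<Lambda>" by order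
  then have "?s l = ennreal (enn2real (?s l))" by (metis ennreal_enn2real ennreal_less_top order_le_less_trans)
  then have "\<bar>b x (a k) $ l\<bar> \<le> enn2real (?s l)" using assms(3) by (intro sup_normD[of "closure S"]) auto
  also have "\<dots> \<le> (\<Sum>i\<in>UNIV. enn2real (?s i))" by (intro member_le_sum) auto
  also have "\<dots> \<le> Max ((\<lambda>k. \<Sum>i\<in>UNIV. enn2real (sup_norm (closure S) (\<lambda>y. b y (a k) $ i))) ` {1..K})"
    using assms(2) by (intro Max_ge) auto
  finally show ?thesis .
qed

text \<open>The two solutions may solve different equations \<open>Fu = 0\<close> and \<open>Fv = 0\<close>; both are tested with a third
function \<open>F\<close>. The three inequalities of the theorem are instances with \<open>\<tau> = 0\<close>.\<close>

lemma solution_comparison: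
  fixes S :: "(real^'n::finite) set"
  assumes H1: "H1 K a A S \<nu> \<Lambda> \<theta> g b \<sigma> c f" and F: "shift_monotone K F"
    and u: "is_solution Fu K a S g b \<sigma> c f u" and v: "is_solution Fv K a S g b \<sigma> c f v"
    and "\<kappa> \<ge> 0" and le: "\<And>z. z \<in> RK K \<Longrightarrow> Fu z = 0 \<Longrightarrow> F z \<le> \<tau>"
    and ge: "\<And>z. z \<in> RK K \<Longrightarrow> Fv z = 0 \<Longrightarrow> \<tau> - \<kappa> \<le> F z" and x: "x \<in> closure S"
  shows "v x - u x \<le>
    (exp ((Max ((\<lambda>k. \<Sum>i\<in>UNIV. enn2real (sup_norm (closure S) (\<lambda>y. b y (a k) $ i))) ` {1..K})
                    / (\<nu> / 2) + 1) * diameter S) - 1) * (2 * \<kappa> / \<nu>)"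
proof -
  obtain l :: 'n where True by blast
  have h: "open S" "bounded S" "S \<noteq> {}" "\<nu> > 0" "K \<ge> 1"
    and c: "\<And>k x. k \<in> {1..K} \<Longrightarrow> x \<in> closure S \<Longrightarrow> 0 \<le> c x (a k)"
    and ell: "\<And>k x \<xi>. k \<in> {1..K} \<Longrightarrow> \<xi> \<bullet> ((\<sigma> x (a k) ** transpose (\<sigma> x (a k))) *v \<xi>) \<ge> \<nu> * (\<xi> \<bullet> \<xi>)"
    using H1 unfolding H1_def by blast+
  have R: "RK_vec K z \<in> RK K" for z by (simp add: RK_def RK_vec_def)
  have inS: "x \<in> closure S" if "x \<in> S" for x using that closure_subset by blast
  note bb = drift_bounded[OF H1, of _ _ l]
  show ?thesis
  proof (rule comparison_principle[OF h(1,2) F, where l = l and c = c and a = a and b = b and \<sigma> = \<sigma> and f = f])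
    show "0 \<le> Max ((\<lambda>k. \<Sum>i\<in>UNIV. enn2real (sup_norm (closure S) (\<lambda>y. b y (a k) $ i))) ` {1..K})"
      using bb[of 1] h(3,5) inS by (meson abs_ge_zero all_not_in_conv atLeastAtMost_iff order_refl order_trans)
    show "F (RK_vec K (\<lambda>k. L_op a b \<sigma> c k u y + f y (a k)))
        \<le> F (RK_vec K (\<lambda>k. L_op a b \<sigma> c k v y + f y (a k))) + \<kappa>" if "y \<in> S" for y
      using le[OF R] ge[OF R] u v that unfolding is_solution_def by fastforce
  qed (use h c ell bb u v x assms(5) inS in \<open>auto simp: is_solution_def\<close>)
qed

theorem theorem6p1:
  fixes S :: "(real^'n::finite) set"
    and A :: "'a set"
    and a :: "nat \<Rightarrow> 'a"
    and b :: "real^'n \<Rightarrow> 'a \<Rightarrow> real^'n"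
    and \<sigma> :: "real^'n \<Rightarrow> 'a \<Rightarrow> real^'n^'n"
    and c f :: "real^'n \<Rightarrow> 'a \<Rightarrow> real"
    and g u :: "real^'n \<Rightarrow> real"
    and H :: "(nat \<Rightarrow> real) \<Rightarrow> real"
    and \<rho> :: "(nat \<Rightarrow> real) \<Rightarrow> ereal"
    and ue :: "real \<Rightarrow> real^'n \<Rightarrow> real"
    and \<beta>0 :: "real \<Rightarrow> real \<Rightarrow> real"
  assumes H1: "H1 K a A S \<nu> \<Lambda> \<theta> g b \<sigma> c f"
    and H2: "H2 K H c0 \<rho>"
    and beta0: "regularity_constant TYPE('n) \<beta>0"
    and u: "is_solution (H_zero K) K a S g b \<sigma> c f u"
    and ue: "\<And>\<epsilon>. \<epsilon> > 0 \<Longrightarrow> is_solution (H_eps H \<epsilon>) K a S g b \<sigma> c f (ue \<epsilon>)"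
  shows "(\<forall>\<epsilon>1 \<epsilon>2. \<epsilon>1 \<ge> \<epsilon>2 \<and> \<epsilon>2 > 0 \<longrightarrow> (\<forall>x\<in>closure S. ue \<epsilon>1 x \<ge> ue \<epsilon>2 x))
    \<and> (\<forall>\<beta>. 0 < \<beta> \<and> \<beta> < min (\<beta>0 \<nu> (sigma_bound K a S \<sigma>)) \<theta> \<longrightarrow>
         u \<in> holder_space 2 \<beta> S \<and> (\<forall>\<epsilon>>0. ue \<epsilon> \<in> holder_space 2 \<beta> S)
         \<and> ((\<lambda>\<epsilon>. holder_norm 2 \<beta> S (\<lambda>x. ue \<epsilon> x - u x)) \<longlongrightarrow> 0) (at_right 0))
    \<and> (\<forall>\<epsilon>>0. \<forall>x\<in>closure S.
         0 \<le> ue \<epsilon> x - u x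
         \<and> ue \<epsilon> x - u x \<le>
           (exp ((Max ((\<lambda>k. \<Sum>i\<in>UNIV. enn2real (sup_norm (closure S) (\<lambda>y. b y (a k) $ i))) ` {1..K})
                    / (\<nu> / 2) + 1) * diameter S) - 1) * (2 * \<epsilon> * c0 / \<nu>))"
proof -
  define \<beta>1 where "\<beta>1 = min (\<beta>0 \<nu> (sigma_bound K a S \<sigma>)) \<theta>"
  define E where "E = exp ((Max ((\<lambda>k. \<Sum>i\<in>UNIV. enn2real (sup_norm (closure S) (\<lambda>y. b y (a k) $ i))) ` {1..K})
                    / (\<nu> / 2) + 1) * diameter S) - 1"
  have K: "K \<ge> 1" and S: "open S" "bounded S" "boundary_class 2 \<theta> S" and \<nu>: "\<nu> > 0"
    and g: "g \<in> holder_space 2 \<theta> S"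
    using H1 unfolding H1_def by blast+
  have conv: "RK_convex K H" and c0: "c0 > 0"
    and Hb: "\<forall>x\<in>RK K. H x - c0 \<le> Max (x ` {1..K}) \<and> Max (x ` {1..K}) \<le> H x"
    using H2 unfolding H2_def by blast+
  have smH: "shift_monotone K H" using Hb by (intro shift_monotone_H[OF K conv, of c0]) force
  note bounds = H_eps_bounds[OF K _ _ Hb]
  have mono: "ue \<epsilon>2 x \<le> ue \<epsilon>1 x" if "\<epsilon>2 > 0" "\<epsilon>1 \<ge> \<epsilon>2" "x \<in> closure S" for \<epsilon>1 \<epsilon>2 x
  proof -
    have "\<epsilon>1 > 0" using that by simp
    have "H_eps H \<epsilon>2 z \<le> H_eps H \<epsilon>1 z" if "z \<in> RK K" for z
      using Hb \<open>\<epsilon>2 > 0\<close> \<open>\<epsilon>1 \<ge> \<epsilon>2\<close> that by (intro H_eps_mono[OF K _ _ _ smH]) auto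
    then have "ue \<epsilon>2 x - ue \<epsilon>1 x \<le> E * (2 * 0 / \<nu>)" unfolding E_def
      using \<open>\<epsilon>1 > 0\<close> that
      by (intro solution_comparison[OF H1 shift_monotone_H_eps[OF smH, of \<epsilon>1] ue ue, where \<tau> = 0]) force+
    then show ?thesis by simp
  qed
  have lower: "u x \<le> ue \<epsilon> x" if "\<epsilon> > 0" "x \<in> closure S" for \<epsilon> x
  proof -
    have "u x - ue \<epsilon> x \<le> E * (2 * 0 / \<nu>)" unfolding E_def
      using that bounds(1)
      by (intro solution_comparison[OF H1 shift_monotone_H_eps[OF smH, of \<epsilon>] ue u, where \<tau> = 0]) force+
    then show ?thesis by simp
  qed
  have upper: "ue \<epsilon> x - u x \<le> E * (2 * \<epsilon> * c0 / \<nu>)" if "\<epsilon> > 0" "x \<in> closure S" for \<epsilon> x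
  proof -
    have "ue \<epsilon> x - u x \<le> E * (2 * (\<epsilon> * c0) / \<nu>)" unfolding E_def
      using that bounds(2) c0
      by (intro solution_comparison[OF H1 shift_monotone_H_zero[OF K] u ue, where \<tau> = 0]) force+
    then show ?thesis by (simp add: mult.assoc)
  qed
  note R1 = H1_relabel[OF H1]
  have reg: "ue \<epsilon> \<in> holder_space 2 \<beta>1 S" if \<epsilon>: "\<epsilon> > 0" for \<epsilon>
  proof -
    obtain w where w1: "\<forall>v. is_solution (H_eps H \<epsilon>) K a S g b \<sigma> c f v \<longrightarrow> (\<forall>x\<in>closure S. v x = w x)"
      and w2: "w \<in> holder_space 2 \<beta>1 S"
      using beta0[unfolded regularity_constant_def, THEN conjunct2, THEN conjunct1, rule_format, OF conjI[OF R1 conjI[OF H2 \<epsilon>]]]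
      unfolding is_solution_relabel sigma_bound_relabel \<beta>1_def by blast
    show ?thesis
      by (rule holder_space_cong[OF S(1) _ w2]) (rule w1[rule_format, OF ue[OF \<epsilon>], symmetric])
  qed
  have conv: "u \<in> holder_space 2 \<beta> S \<and> (\<forall>\<epsilon>>0. ue \<epsilon> \<in> holder_space 2 \<beta> S)
         \<and> ((\<lambda>\<epsilon>. holder_norm 2 \<beta> S (\<lambda>x. ue \<epsilon> x - u x)) \<longlongrightarrow> 0) (at_right 0)"
    if \<beta>: "0 < \<beta>" "\<beta> < \<beta>1" for \<beta>
  proof -
    have \<beta>1: "\<beta>1 > 0" "\<beta>1 \<le> \<theta>" using \<beta> by (auto simp: \<beta>1_def)
    obtain C where C: "C \<ge> 0" and apriori: "\<And>\<epsilon>. \<epsilon> > 0 \<Longrightarrow>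
        holder_norm 2 \<beta>1 S (ue \<epsilon>) \<le> ennreal C * (holder_norm 2 \<beta>1 S g + ennreal (\<epsilon> * c0) + 1)"
    proof -
      obtain C where C: "C \<ge> 0" and Cb: "\<forall>K (a :: nat \<Rightarrow> nat) A \<theta> g b \<sigma> c f H c0 \<rho> \<epsilon> u.
          H1 K a A S \<nu> \<Lambda> \<theta> g b \<sigma> c f \<and> H2 K H c0 \<rho> \<and> \<epsilon> > 0
          \<and> 0 < \<beta>1 \<and> \<beta>1 \<le> min (\<beta>0 \<nu> (sigma_bound K a S \<sigma>)) \<theta>
          \<and> is_solution (H_eps H \<epsilon>) K a S g b \<sigma> c f u \<and> u \<in> holder_space 2 \<beta>1 S \<longrightarrow>
          holder_norm 2 \<beta>1 S u \<le> ennreal C * (holder_norm 2 \<beta>1 S g + ennreal (\<epsilon> * c0) + 1)"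
        using beta0[unfolded regularity_constant_def, THEN conjunct2, THEN conjunct2, THEN spec[of _ \<nu>],
            THEN spec[of _ \<Lambda>], THEN spec[of _ \<beta>1], THEN spec[of _ S]]
        by (elim exE conjE) (rule that, assumption+)
      show ?thesis
      proof (rule that[OF C])
        fix \<epsilon> :: real assume "\<epsilon> > 0"
        then show "holder_norm 2 \<beta>1 S (ue \<epsilon>) \<le> ennreal C * (holder_norm 2 \<beta>1 S g + ennreal (\<epsilon> * c0) + 1)"
          using R1 H2 \<beta>1 ue reg
          by (intro Cb[rule_format, of K "\<lambda>k. k" "{1..K}" \<theta> g "\<lambda>x k. b x (a k)" "\<lambda>x k. \<sigma> x (a k)" "\<lambda>x k. c x (a k)" "\<lambda>x k. f x (a k)" H c0 \<rho>])
             (simp add: is_solution_relabel sigma_bound_relabel flip: \<beta>1_def)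
      qed
    qed
    define G where "G = enn2real (holder_norm 2 \<beta>1 S g)"
    have G: "holder_norm 2 \<beta>1 S g = ennreal G" "G \<ge> 0"
      using holder_space_antimono[OF \<beta>1 g] by (auto simp: holder_space_def G_def)
    have seq: "u \<in> holder_space 2 \<beta> S \<and> (\<lambda>n. holder_norm 2 \<beta> S (\<lambda>x. ue (X n) x - u x)) \<longlonglongrightarrow> 0"
      if X: "\<And>n. X n > 0" "X \<longlonglongrightarrow> 0" for X
    proof -
      have "Bseq X" using X(2) by (intro convergent_imp_Bseq convergentI)
      then obtain B where B: "\<And>n. X n \<le> B" unfolding Bseq_def by (metis abs_le_iff real_norm_def)
      then have B0: "B \<ge> 0" using X(1)[of 0] order_trans less_imp_le by blast
      \<comment> \<open>A convergent sequence of parameters is bounded, so the a priori bound is uniform along it.\<close>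
      define N where "N = C * (G + B * c0 + 1)"
      have N0: "N \<ge> 0" using C G B0 c0 by (simp add: N_def)
      have N: "holder_norm 2 \<beta>1 S (ue (X n)) \<le> ennreal N" for n
      proof -
        have "holder_norm 2 \<beta>1 S (ue (X n)) \<le> ennreal C * (ennreal G + ennreal (X n * c0) + 1)"
          using apriori[OF X(1)] G by simp
        also have "\<dots> = ennreal (C * (G + X n * c0 + 1))"
          using C G c0 X(1)[of n] by (simp add: ennreal_mult ennreal_plus less_imp_le)
        also have "\<dots> \<le> ennreal N"
          unfolding N_def using B[of n] C c0 by (intro ennreal_leI mult_left_mono add_mono mult_right_mono) auto
        finally show ?thesis .
      qed
      have lim: "uniform_limit (closure S) (\<lambda>n. ue (X n)) u sequentially"
      proof (rule uniform_limitI)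
        fix e :: real assume "e > 0"
        have "(\<lambda>n. E * (2 * X n * c0 / \<nu>)) \<longlonglongrightarrow> E * (2 * 0 * c0 / \<nu>)"
          using \<nu> by (intro tendsto_intros X) auto
        then have "\<forall>\<^sub>F n in sequentially. E * (2 * X n * c0 / \<nu>) < e"
          using \<open>e > 0\<close> by (intro order_tendstoD) auto
        then show "\<forall>\<^sub>F n in sequentially. \<forall>x\<in>closure S. dist (ue (X n) x) (u x) < e"
        proof (rule eventually_mono, intro ballI)
          fix n x assume "E * (2 * X n * c0 / \<nu>) < e" "x \<in> closure S"
          then show "dist (ue (X n) x) (u x) < e"
            using lower[OF X(1), of x n] upper[OF X(1), of x n] by (simp add: dist_real_def)
        qed
      qed
      have "C_class 2 S u" "continuous_on (closure S) u" using u by (auto simp: is_solution_def)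
      from holder_compactness[OF S \<beta> this reg[OF X(1)] N N0 lim] show ?thesis by blast
    qed
    have "u \<in> holder_space 2 \<beta> S"
      using seq[of "\<lambda>n. inverse (real (Suc n))"] LIMSEQ_inverse_real_of_nat by simp
    moreover have "\<forall>\<epsilon>>0. ue \<epsilon> \<in> holder_space 2 \<beta> S"
      using reg \<beta> by (auto intro: holder_space_antimono[of \<beta> \<beta>1])
    moreover have "((\<lambda>\<epsilon>. holder_norm 2 \<beta> S (\<lambda>x. ue \<epsilon> x - u x)) \<longlongrightarrow> 0) (at_right 0)"
      unfolding tendsto_at_iff_sequentially using seq by (auto simp: o_def)
    ultimately show ?thesis by blast
  qed
  show ?thesis
    using mono lower upper conv unfolding E_def \<beta>1_def by (intro conjI allI impI ballI) auto
qed

end
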